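(* Let $\theta$ be a smooth admissable function with respect to $c>1$ and $\alpha\in(0,2)\setminus\{1\}$. Further, let $f\in L^1(\mathbb{R})$ be a bounded function such that all derivatives of $f$ up to an integer order $n>\alpha+1$ exist and $f^{(n)}\in L^1(\mathbb{R})$. Then for almost every $x\in\mathbb{R}$ we have $$\frac{\partial^{\alpha}}{\partial_{c,\theta}x^{\alpha}}f(x)=\lim_{h\downarrow 0}{}_{h}\Delta^{\alpha}_{c,\theta}f(x)=\lim_{h\downarrow 0}\ \sum_{k=-\infty}^{\infty}\omega_k\,h^{ik\tilde c-\alpha}\sum_{j=0}^{\infty}\binom{\alpha-ik\tilde c}{j}(-1)^jf(x-jh).$$
   Context: Given $c>1$ and $\alpha\in(0,2)$, a function $\theta:\mathbb{R}\to(0,\infty)$ is called admissable (with respect to $c$ and $\alpha$) if it is $\log(c^{1/\alpha})$-periodic and satisfies $\theta(y+\delta)\le e^{\alpha\delta}\theta(y)$ for all $y\in\mathbb{R}$, $\delta\ge 0$. It is called smooth if in addition it is continuous on $\mathbb{R}$ and piecewise continuously differentiable. The Fourier coefficients $(c_k)_{k\in\mathbb{Z}}\subseteq\mathbb{C}$ of a smooth admissable $\theta$ are those in its Fourier series $\theta(x)=\sum_{k=-\infty}^\infty c_ke^{ik\tilde cx}$, where $\tilde c=\frac{2\pi\alpha}{\log c}$. Let $\phi_1$ be the measure on $(0,\infty)$ with $\phi_1(r,\infty)=r^{-\alpha}\theta(\log r)$ for all $r>0$. The (positive) semi-fractional derivative of order $\alpha$ with respect to $c,\theta$ is $$\frac{\partial^{\alpha}}{\partial_{c,\theta}x^{\alpha}}f(x)=\begin{cases}\displaystyle\int_{0+}^\infty(f(x)-f(x-y))\,d\phi_1(y)&\text{if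 }\alpha\in(0,1),\\[2ex]\displaystyle\int_{0+}^\infty(f(x-y)-f(x)+yf'(x))\,d\phi_1(y)&\text{if }\alpha\in(1,2),\end{cases}$$ equivalently, for suitable $f$, the function with Fourier transform $-\psi\widehat f$ if $\alpha\in(0,1)$ and $\psi\widehat f$ if $\alpha\in(1,2)$, where $\psi(x)=\int_{0+}^\infty(e^{ixy}-1)\,d\phi_1(y)$ if $\alpha\in(0,1)$, $\psi(x)=\int_{0+}^\infty(e^{ixy}-1-ixy)\,d\phi_1(y)$ if $\alpha\in(1,2)$, and $\widehat f(x)=\int_{\mathbb{R}}e^{ixy}f(y)\,dy$. The coefficients are $\omega_k=c_k\Gamma(ik\tilde c-\alpha+1)$ if $\alpha\in(0,1)$ and $\omega_k=-c_k\Gamma(ik\tilde c-\alpha+1)$ if $\alpha\in(1,2)$. For $z\in\mathbb{C}$, $\binom{z}{j}=\frac{z(z-1)\cdots(z-j+1)}{j!}$. For $h>0$ and bounded $f$, the Grünwald-Letnikov semi-fractional difference is ${}_{h}\Delta^\alpha_{c,\theta}f(x)=\sum_{k=-\infty}^{\infty}\omega_k\,h^{ik\tilde c-\alpha}\sum_{j=0}^{\infty}\binom{\alpha-ik\tilde c}{j}(-1)^jf(x-jh)$. *)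

theory Defs
  imports "HOL-Analysis.Analysis"
begin

definition admissable :: "real \<Rightarrow> real \<Rightarrow> (real \<Rightarrow> real) \<Rightarrow> bool" where
  "admissable c \<alpha> \<theta> \<longleftrightarrow>
     (\<forall>y. \<theta> y > 0) \<and>
     (\<forall>y. \<theta> (y + ln (c powr (1 / \<alpha>))) = \<theta> y) \<and>
     (\<forall>y \<delta>. \<delta> \<ge> 0 \<longrightarrow> \<theta> (y + \<delta>) \<le> exp (\<alpha> * \<delta>) * \<theta> y)"

text \<open>On a compact interval the derivative is one-sided at the end points.\<close>

definition cont_diff_on_Icc :: "(real \<Rightarrow> real) \<Rightarrow> real \<Rightarrow> real \<Rightarrow> bool" where
  "cont_diff_on_Icc g s t \<longleftrightarrow>
     (\<exists>g'. continuous_on {s..t} g' \<and>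
           (\<forall>x\<in>{s..t}. (g has_real_derivative g' x) (at x within {s..t})))"

text \<open>
  Every compact interval has finitely many break points, and the function is continuously
  differentiable on each closed piece between them. The library's
  \<^const>\<open>piecewise_C1_differentiable_on\<close> is weaker: it does not
  ask for one-sided limits of the derivative at the break points.
\<close>

definition piecewise_cont_diff :: "(real \<Rightarrow> real) \<Rightarrow> bool" where
  "piecewise_cont_diff g \<longleftrightarrow>
     (\<forall>a b. a < b \<longrightarrow>
        (\<exists>S. finite S \<and>
             (\<forall>s t. a \<le> s \<and> s < t \<and> t \<le> b \<and> {s<..<t} \<inter> S = {} \<longrightarrow> cont_diff_on_Icc g s t)))"

definition smooth_admissable :: "real \<Rightarrow> real \<Rightarrow> (real \<Rightarrow> real) \<Rightarrow> bool" where
  "smooth_admissable c \<alpha> \<theta> \<longleftrightarrow>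
     admissable c \<alpha> \<theta> \<and> continuous_on UNIV \<theta> \<and> piecewise_cont_diff \<theta>"

definition c_tilde :: "real \<Rightarrow> real \<Rightarrow> real" where
  "c_tilde c \<alpha> = 2 * pi * \<alpha> / ln c"

text \<open>The frequency \<open>i k c_tilde\<close>, which occurs in all exponents below.\<close>

definition freq :: "real \<Rightarrow> real \<Rightarrow> int \<Rightarrow> complex" where
  "freq c \<alpha> k = \<i> * of_int k * complex_of_real (c_tilde c \<alpha>)"

text \<open>The mean over one period, of length \<open>ln (c powr (1 / \<alpha>)) = 2 * pi / c_tilde c \<alpha>\<close>.\<close>

definition fourier_coeff :: "real \<Rightarrow> real \<Rightarrow> (real \<Rightarrow> real) \<Rightarrow> int \<Rightarrow> complex" where
  "fourier_coeff c \<alpha> \<theta> k =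
     integral {0..ln (c powr (1 / \<alpha>))}
       (\<lambda>x. complex_of_real (\<theta> x) * exp (- freq c \<alpha> k * complex_of_real x))
     / complex_of_real (ln (c powr (1 / \<alpha>)))"

definition is_levy_measure :: "real \<Rightarrow> (real \<Rightarrow> real) \<Rightarrow> real measure \<Rightarrow> bool" where
  "is_levy_measure \<alpha> \<theta> \<phi> \<longleftrightarrow>
     sets \<phi> = sets (restrict_space borel {0<..}) \<and>
     (\<forall>r>0. emeasure \<phi> {r<..} = ennreal (r powr - \<alpha> * \<theta> (ln r)))"

definition semifrac_integrand ::
    "real \<Rightarrow> (real \<Rightarrow> complex) \<Rightarrow> real \<Rightarrow> real \<Rightarrow> complex" where
  "semifrac_integrand \<alpha> f x y =
     (if \<alpha> < 1 then f x - f (x - y)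
      else f (x - y) - f x + of_real y * vector_derivative f (at x))"

text \<open>
  The semi-fractional derivative of order \<open>\<alpha> \<noteq> 1\<close>; the parameters \<open>c\<close>, \<open>\<theta>\<close> enter through the
  measure \<open>\<phi>\<close> only.
\<close>

definition semifrac_deriv ::
    "real \<Rightarrow> real measure \<Rightarrow> (real \<Rightarrow> complex) \<Rightarrow> real \<Rightarrow> complex" where
  "semifrac_deriv \<alpha> \<phi> f x = (LINT y|\<phi>. semifrac_integrand \<alpha> f x y)"

definition omega :: "real \<Rightarrow> real \<Rightarrow> (real \<Rightarrow> real) \<Rightarrow> int \<Rightarrow> complex" where
  "omega c \<alpha> \<theta> k =
     (if \<alpha> < 1 then fourier_coeff c \<alpha> \<theta> k * Gamma (freq c \<alpha> k - of_real \<alpha> + 1)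
      else - fourier_coeff c \<alpha> \<theta> k * Gamma (freq c \<alpha> k - of_real \<alpha> + 1))"

definition GL_inner_term ::
    "real \<Rightarrow> real \<Rightarrow> real \<Rightarrow> (real \<Rightarrow> complex) \<Rightarrow> real \<Rightarrow> int \<Rightarrow> nat \<Rightarrow> complex" where
  "GL_inner_term c \<alpha> h f x k j =
     ((of_real \<alpha> - freq c \<alpha> k) gchoose j) * (- 1) ^ j * f (x - real j * h)"

definition GL_outer_term ::
    "real \<Rightarrow> real \<Rightarrow> (real \<Rightarrow> real) \<Rightarrow> real \<Rightarrow> (real \<Rightarrow> complex) \<Rightarrow> real \<Rightarrow> int \<Rightarrow> complex" where
  "GL_outer_term c \<alpha> \<theta> h f x k =
     omega c \<alpha> \<theta> k * complex_of_real h powr (freq c \<alpha> k - of_real \<alpha>)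
       * (\<Sum>j. GL_inner_term c \<alpha> h f x k j)"

definition GL_difference ::
    "real \<Rightarrow> real \<Rightarrow> (real \<Rightarrow> real) \<Rightarrow> real \<Rightarrow> (real \<Rightarrow> complex) \<Rightarrow> real \<Rightarrow> complex" where
  "GL_difference c \<alpha> \<theta> h f x = (\<Sum>\<^sub>\<infinity>k. GL_outer_term c \<alpha> \<theta> h f x k)"

text \<open>
  \<^const>\<open>suminf\<close> and \<^const>\<open>infsum\<close> have a default value for divergent series, so convergence
  has to be asserted separately.
\<close>

definition GL_converges ::
    "real \<Rightarrow> real \<Rightarrow> (real \<Rightarrow> real) \<Rightarrow> real \<Rightarrow> (real \<Rightarrow> complex) \<Rightarrow> real \<Rightarrow> bool" where
  "GL_converges c \<alpha> \<theta> h f x \<longleftrightarrow>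
     (\<forall>k. summable (GL_inner_term c \<alpha> h f x k)) \<and>
     GL_outer_term c \<alpha> \<theta> h f x summable_on UNIV"

definition nth_deriv :: "nat \<Rightarrow> (real \<Rightarrow> complex) \<Rightarrow> real \<Rightarrow> complex" where
  "nth_deriv k f = ((\<lambda>g x. vector_derivative g (at x)) ^^ k) f"

definition derivs_exist_upto :: "nat \<Rightarrow> (real \<Rightarrow> complex) \<Rightarrow> bool" where
  "derivs_exist_upto n f \<longleftrightarrow> (\<forall>k<n. \<forall>x. nth_deriv k f differentiable at x)"

text \<open>The measure exists: it is the image under \<open>exp\<close> of a Lebesgue-Stieltjes measure.\<close>

lemma is_levy_measure_exists:
  assumes "c > 1" "\<alpha> > 0" and \<theta>: "smooth_admissable c \<alpha> \<theta>"
  shows "\<exists>\<phi>. is_levy_measure \<alpha> \<theta> \<phi>"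
proof -
  define F where "F = (\<lambda>y. - (exp (- \<alpha> * y) * \<theta> y))"
  define p where "p = ln (c powr (1 / \<alpha>))"
  define M where "M = interval_measure F"
  have p: "p > 0" using assms by (simp add: p_def ln_powr)
  have per: "\<theta> (y + p) = \<theta> y" for y
    using \<theta> by (simp add: smooth_admissable_def admissable_def p_def)
  have perm: "\<theta> (y + real m * p) = \<theta> y" for y m
  proof (induction m)
    case (Suc m)
    have "y + real (Suc m) * p = (y + real m * p) + p" by (simp add: algebra_simps)
    then show ?case using per Suc by metis
  qed simp
  have mono: "F x \<le> F y" if "x \<le> y" for x y
  proof -
    have *: "\<forall>y \<delta>. \<delta> \<ge> 0 \<longrightarrow> \<theta> (y + \<delta>) \<le> exp (\<alpha> * \<delta>) * \<theta> y"
      using \<theta> unfolding smooth_admissable_def admissable_def by blast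
    have "\<theta> (x + (y - x)) \<le> exp (\<alpha> * (y - x)) * \<theta> x"
      by (rule *[rule_format]) (use that in simp)
    then have "\<theta> y \<le> exp (\<alpha> * (y - x)) * \<theta> x" by simp
    then have "exp (- \<alpha> * y) * \<theta> y \<le> exp (- \<alpha> * y) * (exp (\<alpha> * (y - x)) * \<theta> x)"
      by (intro mult_left_mono) auto
    also have "\<dots> = exp (- \<alpha> * x) * \<theta> x"
      by (simp add: mult.assoc[symmetric] exp_add[symmetric] algebra_simps)
    finally show ?thesis by (simp add: F_def)
  qed
  have contF: "continuous (at_right a) F" for a
  proof -
    have "continuous_on UNIV \<theta>" using \<theta> by (simp add: smooth_admissable_def)
    then have "continuous_on UNIV F" unfolding F_def by (intro continuous_intros)
    then show ?thesis
      by (simp add: continuous_on_eq_continuous_within continuous_at_imp_continuous_at_within)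
  qed
  have tail: "emeasure M {a<..} = ennreal (exp (- \<alpha> * a) * \<theta> a)" for a
  proof -
    define A where "A = (\<lambda>m. {a<..a + real m * p})"
    have inc: "incseq A"
    proof (rule incseq_SucI)
      fix m show "A m \<le> A (Suc m)" using p by (auto simp: A_def algebra_simps)
    qed
    have U: "(\<Union>m. A m) = {a<..}"
    proof -
      have "\<exists>m. x \<le> a + real m * p" if "x > a" for x
      proof -
        obtain m :: nat where "x - a < real m * p" using reals_Archimedean3[OF p] by blast
        then show ?thesis by (intro exI[of _ m]) linarith
      qed
      then show ?thesis unfolding A_def by auto
    qed
    have "(\<lambda>m. emeasure M (A m)) \<longlonglongrightarrow> emeasure M {a<..}"
      unfolding U[symmetric] by (rule Lim_emeasure_incseq[OF _ inc]) (auto simp: M_def A_def)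
    moreover have "emeasure M (A m) = ennreal (F (a + real m * p) - F a)" for m
      unfolding M_def A_def using p
      by (intro emeasure_interval_measure_Ioc mono contF) auto
    moreover have "(\<lambda>m. ennreal (F (a + real m * p) - F a)) \<longlonglongrightarrow> ennreal (0 - F a)"
    proof (intro tendsto_ennrealI tendsto_diff tendsto_const)
      have eq: "F (a + real m * p) = F a * (exp (- \<alpha> * p)) ^ m" for m
      proof -
        have "exp (- \<alpha> * (a + real m * p)) = exp (- \<alpha> * a + real m * (- \<alpha> * p))"
          by (simp add: algebra_simps)
        also have "\<dots> = exp (- \<alpha> * a) * exp (- \<alpha> * p) ^ m"
          by (simp only: exp_add exp_of_nat_mult)
        finally show ?thesis by (simp add: F_def perm)
      qed
      have "exp (- \<alpha> * p) < 1" using p assms by simp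
      then have "(\<lambda>m. F a * (exp (- \<alpha> * p)) ^ m) \<longlonglongrightarrow> F a * 0"
        by (intro tendsto_mult_left LIMSEQ_power_zero) simp
      then show "(\<lambda>m. F (a + real m * p)) \<longlonglongrightarrow> 0" by (simp add: eq)
    qed
    ultimately have "emeasure M {a<..} = ennreal (0 - F a)"
      using LIMSEQ_unique by auto
    then show ?thesis by (simp add: F_def)
  qed
  define \<phi> where "\<phi> = distr M (restrict_space borel {0<..}) exp"
  have meas: "exp \<in> measurable M (restrict_space borel {0<..})"
  proof (rule measurable_restrict_space2)
    have "(exp :: real \<Rightarrow> real) \<in> borel_measurable borel"
      by (intro borel_measurable_continuous_onI continuous_intros)
    then show "exp \<in> borel_measurable M"
      by (simp add: M_def measurable_def sets_interval_measure)
  qed auto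
  have "emeasure \<phi> {r<..} = ennreal (r powr - \<alpha> * \<theta> (ln r))" if "r > 0" for r
  proof -
    have "{r<..} \<in> sets (restrict_space borel {0<..})"
      using that by (subst sets_restrict_space_iff) auto
    then have "emeasure \<phi> {r<..} = emeasure M (exp -` {r<..} \<inter> space M)"
      unfolding \<phi>_def by (rule emeasure_distr[OF meas])
    also have "exp -` {r<..} \<inter> space M = {ln r<..}"
    proof -
      have "r < exp x \<longleftrightarrow> ln r < x" for x
        using ln_less_cancel_iff[OF that exp_gt_zero[of x]] by simp
      then show ?thesis by (auto simp: M_def)
    qed
    finally show ?thesis using that by (simp add: tail powr_def)
  qed
  then show ?thesis by (intro exI[of _ \<phi>]) (simp add: is_levy_measure_def \<phi>_def)
qed

end

(* Write beta_k = alpha - i k c~ and a_j = Gamma(j+1-beta_k) / j!.  Up to the sign fixed by alpha < 1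
   or alpha > 1, omega_k times the j-th binomial weight is c_k (a_j - a_(j-1)), so one Abel summation
   turns the k-th inner series into c_k times the integral over y > 0 of K_h(y) f'(x-y), where
   K_h(y) = h^(-beta_k) a_j on (jh, (j+1)h].  For alpha > 1 the a_j sum to 0, which permits replacing
   f'(x-y) by g(y) = f'(x-y) - f'(x); for alpha < 1 put g(y) = f'(x-y).  In both cases y^(-alpha) |g(y)|
   is integrable.  As |Gamma z| <= Gamma (Re z), the bound |K_h(y)| <= C y^(-alpha) is uniform in h and k,
   and K_h(y) tends to y^(-beta_k).  Since the Fourier coefficients of the Lipschitz function theta are
   absolutely summable, dominated convergence gives, at every x and without any Fourier transform of f,
   the integral of g(y) y^(-alpha) theta(log y), which is the semi-fractional derivative by Fubini.
   The integrability of f' comes from that of f and of its n-th derivative by finite differences. *)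
theory Submission
  imports Defs
begin

section \<open>Coefficients of the Gruenwald-Letnikov expansion\<close>

text \<open>The obstacle is uniformity in the mode k. The c_k are merely known to be absolutely
  summable, while the binomial weights of order \<beta>_k grow with |k|; the decay of Gamma (1 -
  \<beta>_k) in omega_k has to compensate. Hence the two factors are not estimated separately:
  partial sums of the product have a closed form, and for j \<ge> 1 it is compared with its value at
  real order \<alpha>, one fixed sequence of size j^(-\<alpha>). The closed form reflects generating
  functions. The weights are the Taylor coefficients of (1 - z)^\<beta>, and each partial summation
  divides by 1 - z: once gives the a_j, twice gives their sums, which still decay when Re \<beta> >
  1. The order n enters through boundedness: n > \<alpha> + 1 makes f' bounded and, for \<alpha> >
  1, also f'', so that f' is Lipschitz and the compensated g(y) is O(y) at 0. The k-sums are
  unconditional. Symmetric partial sums therefore only evaluate sums whose existence was settled by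
  absolute bounds.\<close>

lemma norm_Gamma_le:
  fixes z :: complex
  assumes "Re z > 0"
  shows "norm (Gamma z) \<le> Gamma (Re z)"
proof -
  note c = Gamma_integral_complex[OF assms]
  note r = Gamma_integral_real[OF assms]
  have "norm (integral {0..} (\<lambda>t. complex_of_real t powr (z - 1) / of_real (exp t)))
      \<le> integral {0..} (\<lambda>t. t powr (Re z - 1) / exp t)"
    by (rule integral_norm_bound_integral)
       (use c r in \<open>auto simp: norm_divide norm_powr_real_powr has_integral_integrable\<close>)
  then show ?thesis
    using integral_unique[OF c] integral_unique[OF r] by simp
qed

text \<open>For 1 - \<beta> off the poles of Gamma this is Gamma (1 - \<beta>) times the j-th Taylor
  coefficient of (1 - z)^(\<beta> - 1). Keeping the Gamma factor inside allows bounds uniform in the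
  imaginary part of \<beta>.\<close>

definition gl_coeff :: "complex \<Rightarrow> nat \<Rightarrow> complex" where
  "gl_coeff \<beta> j = Gamma (of_nat j + 1 - \<beta>) / fact j"

text \<open>Gauss's product for Gamma at 1 - \<beta>. The variant \<open>Gamma_series'\<close>,
  whose denominator has n rather than n + 1 factors, produces Gamma (n + 1 - \<beta>) with no
  leftover factor.\<close>

lemma gl_coeff_asymp:
  assumes "1 - \<beta> \<notin> \<int>\<^sub>\<le>\<^sub>0"
  shows "(\<lambda>j. gl_coeff \<beta> j * of_nat j powr \<beta>) \<longlonglongrightarrow> 1"
proof -
  let ?z = "1 - \<beta>"
  have G0: "Gamma ?z \<noteq> 0" using assms by (simp add: Gamma_eq_zero_iff)
  have "(\<lambda>n. Gamma ?z / Gamma_series' ?z n) \<longlonglongrightarrow> Gamma ?z / Gamma ?z"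
    by (intro tendsto_intros Gamma_series'_LIMSEQ G0)
  then have "(\<lambda>n. Gamma ?z / Gamma_series' ?z n) \<longlonglongrightarrow> 1" using G0 by simp
  moreover have "eventually (\<lambda>n. Gamma ?z / Gamma_series' ?z n = gl_coeff \<beta> n * of_nat n powr \<beta>) sequentially"
  proof (rule eventually_mono[OF eventually_gt_at_top[of 0]])
    fix n :: nat assume n: "n > 0"
    have f: "(fact n :: complex) = of_nat n * fact (n - 1)"
      using n by (simp add: fact_reduce)
    have e: "exp (?z * of_real (ln (real n))) = of_nat n * exp (- (\<beta> * of_real (ln (real n))))"
    proof -
      have "exp (?z * of_real (ln (real n)))
          = exp (of_real (ln (real n))) * exp (- (\<beta> * of_real (ln (real n))))"
        by (simp add: algebra_simps flip: exp_add)
      moreover have "exp (complex_of_real (ln (real n))) = of_nat n"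
        using n by (subst exp_of_real) simp
      ultimately show ?thesis by simp
    qed
    have p: "of_nat n powr \<beta> = exp (\<beta> * of_real (ln (real n)))"
      using n by (simp add: powr_def Ln_of_nat)
    show "Gamma ?z / Gamma_series' ?z n = gl_coeff \<beta> n * of_nat n powr \<beta>"
      using n G0 unfolding Gamma_series'_def gl_coeff_def e p pochhammer_Gamma[OF assms] f exp_minus
      by (simp add: divide_simps algebra_simps)
  qed
  ultimately show ?thesis by (rule Lim_transform_eventually)
qed

text \<open>Dividing (1 - z)^(\<beta> - 1) once more by 1 - z lowers the exponent to \<beta> - 2,
  and Gamma (2 - \<beta>) = (1 - \<beta>) Gamma (1 - \<beta>) explains the quotient. For 1 < Re
  \<beta> < 2 the right-hand side tends to 0, which is why subtracting f'(x) costs nothing in the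
  limit.\<close>

lemma sum_gl_coeff:
  assumes "1 - \<beta> \<notin> \<int>\<^sub>\<le>\<^sub>0"
  shows "(\<Sum>j\<le>N. gl_coeff \<beta> j) = gl_coeff (\<beta> - 1) N / (1 - \<beta>)"
proof -
  have np: "of_nat N + 1 - \<beta> \<notin> \<int>\<^sub>\<le>\<^sub>0" for N
  proof
    assume "of_nat N + 1 - \<beta> \<in> \<int>\<^sub>\<le>\<^sub>0"
    then obtain m :: nat where "of_nat N + 1 - \<beta> = - of_nat m" by (auto elim!: nonpos_Ints_cases')
    then have "1 - \<beta> = - of_nat (m + N)" by (simp add: algebra_simps)
    then have "1 - \<beta> \<in> \<int>\<^sub>\<le>\<^sub>0" by (metis minus_of_nat_in_nonpos_Ints)
    then show False using assms by contradiction
  qed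
  have nz: "1 - \<beta> \<noteq> 0" using assms by (auto simp: zero_in_nonpos_Ints)
  have st: "gl_coeff (\<beta> - 1) N = (of_nat N + 1 - \<beta>) * gl_coeff \<beta> N" for N
    using Gamma_plus1[OF np[of N]] by (simp add: gl_coeff_def algebra_simps)
  show ?thesis
  proof (induction N)
    case 0
    then show ?case using nz by (simp add: st)
  next
    case (Suc N)
    let ?X = "gl_coeff \<beta> (Suc N)"
    have e: "of_nat N + 1 - (\<beta> - 1) = of_nat (Suc N) + 1 - \<beta>" by simp
    have 1: "gl_coeff (\<beta> - 1) N = of_nat (Suc N) * ?X"
      unfolding gl_coeff_def e by (simp del: of_nat_Suc)
    have "(\<Sum>j\<le>Suc N. gl_coeff \<beta> j) = gl_coeff (\<beta> - 1) N / (1 - \<beta>) + gl_coeff \<beta> (Suc N)"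
      using Suc by simp
    also have "\<dots> = (of_nat (Suc N) + (1 - \<beta>)) * ?X / (1 - \<beta>)"
      unfolding 1 using nz by (simp only: distrib_right add_divide_distrib) simp
    also have "of_nat (Suc N) + (1 - \<beta>) = of_nat (Suc N) + 1 - \<beta>" by simp
    finally show ?case unfolding st .
  qed
qed

text \<open>Alternating partial sums of binomial coefficients collapse to (-1)^N times (\<beta> - 1
  choose N), which is a rising factorial of 1 - \<beta> over N!; the factor Gamma (1 - \<beta>)
  turns it into a single Gamma value.\<close>

lemma sum_gbinomial_eq_gl_coeff:
  fixes \<beta> :: complex
  assumes "1 - \<beta> \<notin> \<int>\<^sub>\<le>\<^sub>0"
  shows "(\<Sum>j\<le>N. Gamma (1 - \<beta>) * ((\<beta> gchoose j) * (- 1) ^ j)) = gl_coeff \<beta> N"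
proof -
  have "(\<Sum>j\<le>N. Gamma (1 - \<beta>) * ((\<beta> gchoose j) * (- 1) ^ j))
      = Gamma (1 - \<beta>) * ((- 1) ^ N * (\<beta> - 1 gchoose N))"
    by (simp add: gbinomial_sum_lower_neg flip: sum_distrib_left)
  also have "\<dots> = Gamma (1 - \<beta>) * (pochhammer (1 - \<beta>) N / fact N)"
    by (simp add: gbinomial_pochhammer mult.assoc[symmetric] flip: power_mult_distrib)
  also have "\<dots> = gl_coeff \<beta> N"
    using assms by (simp add: pochhammer_Gamma gl_coeff_def Gamma_eq_zero_iff algebra_simps)
  finally show ?thesis .
qed

lemma sum_by_parts:
  fixes b u :: "nat \<Rightarrow> 'a::comm_ring_1"
  shows "(\<Sum>j\<le>N. b j * u j) =
    (\<Sum>j\<le>N. b j) * u (Suc N) + (\<Sum>j\<le>N. (\<Sum>i\<le>j. b i) * (u j - u (Suc j)))"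
  by (induction N) (auto simp: algebra_simps)

lemma gl_coeff_tendsto_0:
  assumes "1 - \<beta> \<notin> \<int>\<^sub>\<le>\<^sub>0" "Re \<beta> > 0"
  shows "gl_coeff \<beta> \<longlonglongrightarrow> 0"
proof -
  have "(\<lambda>j. norm (of_nat j powr - \<beta> :: complex)) \<longlonglongrightarrow> 0"
  proof -
    have "(\<lambda>j. real j powr - Re \<beta>) \<longlonglongrightarrow> 0"
      using assms by (intro tendsto_neg_powr) (auto intro: filterlim_real_sequentially)
    moreover have "norm (of_nat j powr - \<beta> :: complex) = real j powr - Re \<beta>" for j
      using norm_powr_real_powr[of "real j" "- \<beta>"] by simp
    ultimately show ?thesis by simp
  qed
  then have "(\<lambda>j. of_nat j powr - \<beta> :: complex) \<longlonglongrightarrow> 0" by (rule tendsto_norm_zero_cancel)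
  from tendsto_mult[OF gl_coeff_asymp[OF assms(1)] this]
  have "(\<lambda>j. gl_coeff \<beta> j * of_nat j powr \<beta> * of_nat j powr - \<beta>) \<longlonglongrightarrow> 0" by simp
  then show ?thesis
  proof (rule Lim_transform_eventually)
    \<comment> \<open>\<open>0 powr z\<close> is 0, so the two powers cancel only for j > 0.\<close>
    show "eventually (\<lambda>j. gl_coeff \<beta> j * of_nat j powr \<beta> * of_nat j powr - \<beta> = gl_coeff \<beta> j) sequentially"
      using eventually_gt_at_top[of 0]
      by eventually_elim (simp add: powr_minus)
  qed
qed

lemma one_minus_notin_nonpos_Ints:
  assumes "0 < Re \<beta>" "Re \<beta> < 2" "Re \<beta> \<noteq> 1"
  shows "1 - \<beta> \<notin> \<int>\<^sub>\<le>\<^sub>0"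
proof
  assume "1 - \<beta> \<in> \<int>\<^sub>\<le>\<^sub>0"
  then obtain n :: nat where "1 - \<beta> = - of_nat n" by (auto elim!: nonpos_Ints_cases')
  then have "1 - Re \<beta> = - real n" by (metis Re_complex_of_real minus_complex.simps(1) one_complex.simps(1) of_real_of_nat_eq uminus_complex.simps(1))
  then have "real n < 1" "real n \<noteq> 0" using assms by linarith+
  then show False by simp
qed

text \<open>For j \<ge> 1 the argument of Gamma has positive real part, so the Gamma integral passes
  to real order \<alpha>, where the asymptotics bound one convergent sequence; imaginary parts never
  enter the constant. At j = 0 and \<alpha> > 1 the real part is negative, and the functional
  equation first moves it to 2 - \<alpha>. The base j + 1 avoids the value 0 of
  \<open>0 powr\<close> at j = 0.\<close>

lemma gl_coeff_bound:
  assumes \<alpha>: "0 < \<alpha>" "\<alpha> < 2" "\<alpha> \<noteq> 1"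
  shows "\<exists>C>0. \<forall>\<beta> j. Re \<beta> = \<alpha> \<longrightarrow> norm (gl_coeff \<beta> j) \<le> C * (real j + 1) powr - \<alpha>"
proof -
  have np: "1 - complex_of_real \<alpha> \<notin> \<int>\<^sub>\<le>\<^sub>0"
    by (rule one_minus_notin_nonpos_Ints) (use \<alpha> in auto)
  obtain B where B: "\<And>j. norm (gl_coeff \<alpha> j * of_nat j powr complex_of_real \<alpha>) \<le> B"
    using convergent_imp_Bseq[OF convergentI[OF gl_coeff_asymp[OF np]]] unfolding Bseq_def by blast
  have B0: "B \<ge> 0" by (rule order_trans[OF norm_ge_zero B[of 0]])
  \<comment> \<open>Bounds the entry j = 0. The denominator \<alpha> - 1 is the least modulus of 1 -
    \<beta> on the line Re \<beta> = \<alpha>, picked up by the functional equation.\<close>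
  define C0 where "C0 = (if \<alpha> < 1 then Gamma (1 - \<alpha>) else Gamma (2 - \<alpha>) / (\<alpha> - 1))"
  have C0: "norm (Gamma (1 - \<beta>)) \<le> C0" if "Re \<beta> = \<alpha>" for \<beta>
  proof (cases "\<alpha> < 1")
    case True
    then show ?thesis using norm_Gamma_le[of "1 - \<beta>"] that by (simp add: C0_def)
  next
    case False
    have "1 - \<beta> \<notin> \<int>\<^sub>\<le>\<^sub>0" by (rule one_minus_notin_nonpos_Ints) (use \<alpha> that in auto)
    from Gamma_plus1[OF this] have e: "Gamma (2 - \<beta>) = (1 - \<beta>) * Gamma (1 - \<beta>)"
      by (simp add: algebra_simps)
    have n1: "norm (1 - \<beta>) \<ge> \<alpha> - 1" using abs_Re_le_cmod[of "1 - \<beta>"] that by simp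
    have "(\<alpha> - 1) * norm (Gamma (1 - \<beta>)) \<le> norm (1 - \<beta>) * norm (Gamma (1 - \<beta>))"
      using n1 by (intro mult_right_mono) auto
    also have "\<dots> = norm (Gamma (2 - \<beta>))" using e by (simp add: norm_mult)
    also have "\<dots> \<le> Gamma (2 - \<alpha>)" using norm_Gamma_le[of "2 - \<beta>"] that \<alpha> by simp
    finally show ?thesis using False \<alpha> by (simp add: C0_def field_simps)
  qed
  have C00: "C0 \<ge> 0"
    by (rule order_trans[OF norm_ge_zero C0[of "complex_of_real \<alpha>"]]) simp
  \<comment> \<open>\<open>2 powr \<alpha>\<close> pays for replacing j by j + 1, as j + 1 \<le> 2 j
    for j \<ge> 1; the summand 1 makes C positive.\<close>
  define C where "C = C0 + B * 2 powr \<alpha> + 1"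
  have Cp: "C > 0" unfolding C_def using C00 B0 by (simp add: add_nonneg_pos)
  have "norm (gl_coeff \<beta> j) \<le> C * (real j + 1) powr - \<alpha>" if \<beta>: "Re \<beta> = \<alpha>" for \<beta> j
  proof (cases "j = 0")
    case True
    then show ?thesis using C0[OF \<beta>] B0 by (simp add: gl_coeff_def C_def add_increasing2)
  next
    case False
    then have j: "real j \<ge> 1" by simp
    have pos: "real j + 1 - \<alpha> > 0" using j \<alpha> by linarith
    have "norm (gl_coeff \<beta> j) \<le> Gamma (real j + 1 - \<alpha>) / fact j"
      using norm_Gamma_le[of "of_nat j + 1 - \<beta>"] pos \<beta>
      by (simp add: gl_coeff_def norm_divide divide_right_mono)
    also have "\<dots> = norm (gl_coeff \<alpha> j)"
    proof -
      have "Gamma (of_nat j + 1 - complex_of_real \<alpha>) = of_real (Gamma (real j + 1 - \<alpha>))"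
        by (simp flip: Gamma_complex_of_real)
      then show ?thesis using Gamma_real_pos[OF pos] by (simp add: gl_coeff_def norm_divide)
    qed
    also have "\<dots> = norm (gl_coeff \<alpha> j * of_nat j powr complex_of_real \<alpha>) * real j powr - \<alpha>"
    proof -
      have "norm (of_nat j powr complex_of_real \<alpha>) = real j powr \<alpha>"
        using norm_powr_real_powr[of "real j" "complex_of_real \<alpha>"] j by simp
      moreover have "real j powr \<alpha> * real j powr - \<alpha> = 1"
        using j by (simp flip: powr_add)
      ultimately show ?thesis by (simp only: norm_mult mult.assoc mult_1_right)
    qed
    also have "\<dots> \<le> B * real j powr - \<alpha>" by (intro mult_right_mono B) auto
    also have "\<dots> \<le> B * (2 powr \<alpha> * (real j + 1) powr - \<alpha>)"
    proof -
      have "(real j + 1) powr \<alpha> \<le> (2 * real j) powr \<alpha>" using j \<alpha> by (intro powr_mono2) auto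
      also have "\<dots> = 2 powr \<alpha> * real j powr \<alpha>" using j by (simp add: powr_mult)
      finally have "real j powr - \<alpha> \<le> 2 powr \<alpha> * (real j + 1) powr - \<alpha>"
        using j by (simp add: powr_minus divide_simps)
      then show ?thesis using B0 by (rule mult_left_mono)
    qed
    also have "\<dots> \<le> C * (real j + 1) powr - \<alpha>"
    proof -
      have "B * 2 powr \<alpha> \<le> C" using C00 by (simp add: C_def)
      from mult_right_mono[OF this, of "(real j + 1) powr - \<alpha>"] show ?thesis by (simp add: mult.assoc)
    qed
    finally show ?thesis .
  qed
  then show ?thesis using Cp by blast
qed

section \<open>Integrability of intermediate derivatives\<close>

lemma integrable_shift:
  fixes g :: "real \<Rightarrow> 'a::{banach, second_countable_topology}"
  assumes "integrable lborel g"
  shows "integrable lborel (\<lambda>x. g (x + s))"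
  using lborel_integrable_real_affine[OF assms, of 1 s] by (simp add: add.commute)

lemma has_vector_derivative_shift:
  fixes G :: "real \<Rightarrow> 'a::real_normed_vector"
  assumes "(G has_vector_derivative g) (at (x + s))"
  shows "((\<lambda>t. G (x + t)) has_vector_derivative g) (at s)"
    and "((\<lambda>t. G (t + s)) has_vector_derivative g) (at x)"
proof -
  have "((\<lambda>t. x + t) has_vector_derivative 1) (at s)" "((\<lambda>t. t + s) has_vector_derivative 1) (at x)"
    by (auto intro!: derivative_eq_intros)
  from this[THEN vector_diff_chain_at, of G g] assms
  show "((\<lambda>t. G (x + t)) has_vector_derivative g) (at s)"
    and "((\<lambda>t. G (t + s)) has_vector_derivative g) (at x)" by (simp_all add: o_def)
qed

lemma has_integral_indicator_UNIV:
  fixes f :: "real \<Rightarrow> 'a::banach"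
  assumes "(f has_integral I) S"
  shows "((\<lambda>t. indicat_real S t *\<^sub>R f t) has_integral I) UNIV"
proof -
  have "(\<lambda>t. indicat_real S t *\<^sub>R f t) = (\<lambda>t. if t \<in> S then f t else 0)"
    by (auto simp: indicator_def)
  then show ?thesis using assms by (simp only: has_integral_restrict_UNIV)
qed

text \<open>By translation invariance, swapping the integrals gives the total mass of |g|. The
  window is an L1 majorant for all increments, over steps of length at most 1, of a primitive of
  g.\<close>

lemma integrable_window:
  fixes g :: "real \<Rightarrow> 'a::{banach, second_countable_topology}"
  assumes g: "integrable lborel g"
  shows "integrable lborel (\<lambda>x. LINT s|lborel. indicat_real {0..1} s * norm (g (x + s)))"
proof -
  have [measurable]: "g \<in> borel_measurable borel" using g by auto
  define F where "F = (\<lambda>(s, x). indicat_real {0..1} s * norm (g (x + s)))"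
  have "integrable (lborel \<Otimes>\<^sub>M lborel) F"
  proof (rule lborel_pair.Fubini_integrable)
    show "F \<in> borel_measurable (lborel \<Otimes>\<^sub>M lborel)"
      unfolding F_def by measurable
    have e: "(LINT x|lborel. norm (g (x + s))) = (LINT x|lborel. norm (g x))" for s
      using lborel_integral_real_affine[of 1 "\<lambda>x. norm (g x)" s] by (simp add: add.commute)
    show "integrable lborel (\<lambda>s. LINT x|lborel. norm (F (s, x)))"
      by (simp add: F_def abs_mult e mult.commute)
    show "AE s in lborel. integrable lborel (\<lambda>x. F (s, x))"
      unfolding F_def using integrable_shift[OF g] by auto
  qed
  then show ?thesis unfolding F_def using lborel_pair.integrable_snd[of "\<lambda>s x. indicat_real {0..1} s * norm (g (x + s))"] by simp
qed

lemma increment_le_window: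
  fixes G :: "real \<Rightarrow> 'a::euclidean_space"
  assumes der: "\<And>x. (G has_vector_derivative g x) (at x)"
    and g: "integrable lborel g" and s: "0 \<le> s" "s \<le> 1"
  shows "norm (G (x + s) - G x) \<le> (LINT s|lborel. indicat_real {0..1} s * norm (g (x + s)))"
proof -
  let ?w = "\<lambda>t. indicat_real {0..1} t * norm (g (x + t))"
  have gi: "integrable lborel (\<lambda>t. g (x + t))"
    using integrable_shift[OF g, of x] by (simp add: add.commute)
  have wi: "integrable lborel ?w"
    by (rule integrable_real_mult_indicator[where A="{0..1}", of lborel "\<lambda>t. norm (g (x+t))", simplified mult.commute]) (use gi in auto)
  have 1: "((\<lambda>t. g (x + t)) has_integral (G (x + s) - G (x + 0))) {0..s}"
  proof (rule fundamental_theorem_of_calculus[OF s(1)])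
    fix t show "((\<lambda>t. G (x + t)) has_vector_derivative g (x + t)) (at t within {0..s})"
      by (rule has_vector_derivative_at_within[OF has_vector_derivative_shift(1)[OF der]])
  qed
  have 2: "((\<lambda>t. indicat_real {0..s} t *\<^sub>R g (x + t)) has_integral (G (x + s) - G x)) UNIV"
    by (rule has_integral_indicator_UNIV) (use 1 in simp)
  have "norm (integral UNIV (\<lambda>t. indicat_real {0..s} t *\<^sub>R g (x + t))) \<le> integral UNIV ?w"
  proof (rule integral_norm_bound_integral)
    show "(\<lambda>t. indicat_real {0..s} t *\<^sub>R g (x + t)) integrable_on UNIV"
      using 2 by (rule has_integral_integrable)
    show "?w integrable_on UNIV" using wi by (rule integrable_on_lborel)
    show "norm (indicat_real {0..s} t *\<^sub>R g (x + t)) \<le> ?w t" for t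
      using s by (auto simp: indicator_def)
  qed
  then show ?thesis using integral_unique[OF 2] integral_lborel[OF wi] by simp
qed

text \<open>Induction through unit differences: the family G_k (x + 1) - G_k x is one level shorter,
  since its top member is dominated by the window of the last derivative and so is integrable. The
  induction hypothesis yields integrability of its penultimate member, which differs from the wanted
  derivative by at most the same window.\<close>

lemma integrable_penultimate_deriv:
  fixes G :: "nat \<Rightarrow> real \<Rightarrow> 'a::euclidean_space"
  assumes "\<And>k x. k \<le> n \<Longrightarrow> (G k has_vector_derivative G (Suc k) x) (at x)"
    and "integrable lborel (G 0)" and "integrable lborel (G (Suc n))"
  shows "integrable lborel (G n)"
  using assms
proof (induction n arbitrary: G)
  case (Suc n)
  note der = Suc.prems(1)
  define w where "w x = (LINT s|lborel. indicat_real {0..1} s * norm (G (Suc (Suc n)) (x + s)))" for x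
  have w: "integrable lborel w"
    unfolding w_def by (rule integrable_window[OF Suc.prems(3)])
  have cont: "continuous_on UNIV (G k)" if "k \<le> Suc n" for k
    by (intro continuous_at_imp_continuous_on ballI has_vector_derivative_continuous[OF der[OF that]])
  have [measurable]: "G k \<in> borel_measurable borel" if "k \<le> Suc n" for k
    using cont[OF that] by (intro borel_measurable_continuous_onI)
  have wb: "norm (G (Suc n) (x + s) - G (Suc n) x) \<le> w x" if "0 \<le> s" "s \<le> 1" for x s
    unfolding w_def by (rule increment_le_window[OF der Suc.prems(3) that]) simp
  define F where "F k x = G k (x + 1) - G k x" for k x
  have "integrable lborel (F n)"
  proof (rule Suc.IH)
    fix k x assume "k \<le> n"
    then show "(F k has_vector_derivative F (Suc k) x) (at x)"
      unfolding F_def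
      by (intro has_vector_derivative_diff has_vector_derivative_shift(2)[OF der] der) auto
  next
    show "integrable lborel (F 0)"
      unfolding F_def by (intro Bochner_Integration.integrable_diff integrable_shift Suc.prems(2))
    show "integrable lborel (F (Suc n))"
    proof (rule Bochner_Integration.integrable_bound[OF w])
      show "F (Suc n) \<in> borel_measurable lborel" unfolding F_def by measurable
      show "AE x in lborel. norm (F (Suc n) x) \<le> norm (w x)"
      proof (rule AE_I2)
        show "norm (F (Suc n) x) \<le> norm (w x)" for x
          using wb[of 1 x] by (simp add: F_def)
      qed
    qed
  qed
  then have i: "integrable lborel (\<lambda>x. norm (F n x) + w x)" using w by auto
  have "norm (G (Suc n) x) \<le> norm (F n x) + w x" for x
  proof -
    \<comment> \<open>Mean value inequality on [0, 1] for \<open>G n (x + s)\<close> minus its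
      linear part in s. The derivative of this difference is an increment of
      \<open>G (Suc n)\<close> over s \<le> 1, which \<open>w x\<close> bounds for all s at
      once.\<close>
    have "norm ((G n (x + 1) - 1 *\<^sub>R G (Suc n) x) - (G n (x + 0) - 0 *\<^sub>R G (Suc n) x)) \<le> w x * norm (1 - 0 :: real)"
    proof (rule differentiable_bound[where S="{0..1}" and f="\<lambda>s. G n (x + s) - s *\<^sub>R G (Suc n) x"])
      fix s :: real assume s: "s \<in> {0..1}"
      have "((\<lambda>s. G n (x + s) - s *\<^sub>R G (Suc n) x) has_vector_derivative G (Suc n) (x + s) - G (Suc n) x) (at s)"
        by (rule derivative_eq_intros has_vector_derivative_shift(1)[OF der] refl | simp)+
      then show "((\<lambda>s. G n (x + s) - s *\<^sub>R G (Suc n) x) has_derivative (\<lambda>t. t *\<^sub>R (G (Suc n) (x + s) - G (Suc n) x))) (at s within {0..1})"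
        unfolding has_vector_derivative_def by (rule has_derivative_at_withinI)
      show "onorm (\<lambda>t. t *\<^sub>R (G (Suc n) (x + s) - G (Suc n) x)) \<le> w x"
        using wb[of s x] s by (intro onorm_le) (auto simp: mult.commute mult_left_mono)
    qed auto
    then have "norm (F n x - G (Suc n) x) \<le> w x" by (simp add: F_def algebra_simps)
    then show ?thesis using norm_triangle_ineq2[of "G (Suc n) x" "F n x"] by (simp add: norm_minus_commute)
  qed
  then have "norm (G (Suc n) x) \<le> norm (norm (F n x) + w x)" for x
    by (rule order_trans) simp
  then show ?case
    by (intro Bochner_Integration.integrable_bound[OF i]) auto
qed simp

text \<open>Descends from n one order at a time: order 0 and order m + 1 together give order
  m.\<close>

lemma integrable_intermediate_deriv:
  fixes G :: "nat \<Rightarrow> real \<Rightarrow> 'a::euclidean_space"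
  assumes "\<And>k x. k < n \<Longrightarrow> (G k has_vector_derivative G (Suc k) x) (at x)"
    and "integrable lborel (G 0)" and "integrable lborel (G n)" and "k \<le> n"
  shows "integrable lborel (G k)"
  using \<open>k \<le> n\<close>
proof (induction rule: inc_induct)
  case (step m)
  then show ?case using assms by (intro integrable_penultimate_deriv[of m G]) auto
qed (use assms in auto)

lemma bounded_if_deriv_integrable:
  fixes G :: "real \<Rightarrow> 'a::euclidean_space"
  assumes der: "\<And>x. (G has_vector_derivative g x) (at x)"
    and G: "integrable lborel G" and g: "integrable lborel g"
  shows "\<exists>B. \<forall>x. norm (G x) \<le> B"
proof -
  define L where "L = (LINT t|lborel. norm (g t))"
  have "norm (G b - G a) \<le> L" if "a \<le> b" for a b
  proof -
    have 1: "(g has_integral (G b - G a)) {a..b}"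
      by (rule fundamental_theorem_of_calculus[OF that]) (use der in \<open>auto intro: has_vector_derivative_at_within\<close>)
    have 2: "((\<lambda>t. indicat_real {a..b} t *\<^sub>R g t) has_integral (G b - G a)) UNIV"
      by (rule has_integral_indicator_UNIV) (use 1 in simp)
    have ni: "integrable lborel (\<lambda>t. norm (g t))" using g by auto
    have "norm (integral UNIV (\<lambda>t. indicat_real {a..b} t *\<^sub>R g t)) \<le> integral UNIV (\<lambda>t. norm (g t))"
      by (rule integral_norm_bound_integral)
         (use 2 integrable_on_lborel[OF ni] in \<open>auto simp: indicator_def has_integral_integrable\<close>)
    then show ?thesis using integral_unique[OF 2] integral_lborel[OF ni] by (simp add: L_def)
  qed
  then have "norm (G x - G 0) \<le> L" for x
    by (metis linear norm_minus_commute)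
  then have "norm (G x) \<le> L + norm (G 0)" for x
    using norm_triangle_ineq2[of "G x" "G 0"] by (smt (verit))
  then show ?thesis by blast
qed

lemma nth_deriv_has_vector_derivative:
  assumes "derivs_exist_upto n f" "k < n"
  shows "(nth_deriv k f has_vector_derivative nth_deriv (Suc k) f x) (at x)"
proof -
  have "nth_deriv k f differentiable at x" using assms by (simp add: derivs_exist_upto_def)
  then have "(nth_deriv k f has_vector_derivative vector_derivative (nth_deriv k f) (at x)) (at x)"
    by (simp only: vector_derivative_works)
  then show ?thesis by (simp add: nth_deriv_def)
qed

lemma nth_deriv_integrable:
  assumes "derivs_exist_upto n f" "integrable lborel f" "integrable lborel (nth_deriv n f)" "k \<le> n"
  shows "integrable lborel (nth_deriv k f)"
  by (rule integrable_intermediate_deriv[OF nth_deriv_has_vector_derivative[OF assms(1)] _ assms(3,4)])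
     (use assms(2) in \<open>auto simp: nth_deriv_def id_def\<close>)

section \<open>Fourier series of Lipschitz periodic functions\<close>

text \<open>The integral of |g - S|^2 is nonnegative, S being the orthogonal projection of g onto
  the span of the e_k with k in K. The coefficients are not normalized and each e_k has squared norm
  p, whence the factor p on the right.\<close>

lemma (in finite_measure) bessel_inequality:
  fixes e :: "'b \<Rightarrow> 'a \<Rightarrow> complex" and g :: "'a \<Rightarrow> complex"
  assumes e [measurable]: "\<And>k. e k \<in> borel_measurable M" and e1: "\<And>k x. norm (e k x) \<le> 1"
    and ortho: "\<And>k l. (LINT x|M. e k x * cnj (e l x)) = (if k = l then of_real p else 0)"
    and p: "p > 0"
    and g [measurable]: "g \<in> borel_measurable M" and gB: "\<And>x. norm (g x) \<le> B"
    and K: "finite K"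
  shows "(\<Sum>k\<in>K. (norm (LINT x|M. g x * cnj (e k x)))\<^sup>2) \<le> p * (LINT x|M. (norm (g x))\<^sup>2)"
proof -
  define G where "G k = (LINT x|M. g x * cnj (e k x))" for k
  define S where "S x = (\<Sum>k\<in>K. G k / of_real p * e k x)" for x
  define T where "T = (\<Sum>k\<in>K. (norm (G k))\<^sup>2)"
  have [measurable]: "cnj \<in> borel_measurable borel"
    by (intro borel_measurable_continuous_onI continuous_intros)
  have B0: "B \<ge> 0" using gB order_trans[OF norm_ge_zero] by blast
  have int_ge: "integrable M (\<lambda>x. g x * cnj (e k x))" for k
  proof (rule integrable_const_bound[of _ B])
    show "AE x in M. norm (g x * cnj (e k x)) \<le> B"
      using gB e1 B0 by (auto simp: norm_mult intro!: AE_I2 mult_mono[where d=1 and b=B, simplified])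
  qed measurable
  have int_eg: "integrable M (\<lambda>x. cnj (g x) * e k x)" for k
    using Bochner_Integration.integrable_cnj[of M "\<lambda>x. g x * cnj (e k x)"] int_ge[of k] by simp
  have int_ee: "integrable M (\<lambda>x. e k x * cnj (e l x))" for k l
  proof (rule integrable_const_bound[of _ 1])
    show "AE x in M. norm (e k x * cnj (e l x)) \<le> 1"
      using e1 by (auto simp: norm_mult intro!: AE_I2 mult_le_one)
  qed measurable
  have int_gg: "integrable M (\<lambda>x. g x * cnj (g x))"
  proof (rule integrable_const_bound[of _ "B * B"])
    show "AE x in M. norm (g x * cnj (g x)) \<le> B * B"
      using gB B0 by (auto simp: norm_mult intro!: AE_I2 mult_mono)
  qed measurable
  have Ieg: "(LINT x|M. cnj (g x) * e k x) = cnj (G k)" for k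
    using Bochner_Integration.integral_cnj[of M "\<lambda>x. g x * cnj (e k x)"] by (simp add: G_def)
  \<comment> \<open>Expanded over the complex numbers, the square is a finite sum of products to
    which orthogonality applies. After integration the three sums become T / p with the signs -, -,
    +.\<close>
  have exp: "of_real ((norm (g x - S x))\<^sup>2) = g x * cnj (g x)
     - (\<Sum>k\<in>K. cnj (G k) / of_real p * (g x * cnj (e k x)))
     - (\<Sum>k\<in>K. G k / of_real p * (cnj (g x) * e k x))
     + (\<Sum>k\<in>K. \<Sum>l\<in>K. G k / of_real p * (cnj (G l) / of_real p) * (e k x * cnj (e l x)))" for x
  proof -
    have 1: "g x * cnj (S x) = (\<Sum>k\<in>K. cnj (G k) / of_real p * (g x * cnj (e k x)))"
      by (simp add: S_def sum_distrib_left algebra_simps)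
    have 2: "cnj (g x) * S x = (\<Sum>k\<in>K. G k / of_real p * (cnj (g x) * e k x))"
      by (simp add: S_def sum_distrib_left algebra_simps)
    have 3: "S x * cnj (S x) = (\<Sum>k\<in>K. \<Sum>l\<in>K. G k / of_real p * (cnj (G l) / of_real p) * (e k x * cnj (e l x)))"
      by (simp add: S_def sum_product algebra_simps)
    show ?thesis unfolding complex_norm_square 1[symmetric] 2[symmetric] 3[symmetric]
      by (simp add: algebra_simps)
  qed
  have "(LINT x|M. complex_of_real ((norm (g x - S x))\<^sup>2)) = (LINT x|M. g x * cnj (g x))
     - (\<Sum>k\<in>K. cnj (G k) / of_real p * G k)
     - (\<Sum>k\<in>K. G k / of_real p * cnj (G k))
     + (\<Sum>k\<in>K. \<Sum>l\<in>K. G k / of_real p * (cnj (G l) / of_real p) * (if k = l then of_real p else 0))"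
    unfolding exp
    by (subst Bochner_Integration.integral_add Bochner_Integration.integral_diff Bochner_Integration.integral_sum
       | intro Bochner_Integration.integrable_add Bochner_Integration.integrable_diff Bochner_Integration.integrable_sum
         integrable_mult_right int_gg int_ee int_ge int_eg
       | simp only: integral_mult_right_zero Ieg ortho G_def[symmetric])+
  also have "(\<Sum>k\<in>K. \<Sum>l\<in>K. G k / of_real p * (cnj (G l) / of_real p) * (if k = l then of_real p else 0))
      = (\<Sum>k\<in>K. G k / of_real p * cnj (G k))"
    using K p by (intro sum.cong) (simp_all add: if_distrib[of "\<lambda>x. _ * x"] sum.delta' cong: if_cong)
  also have "(\<Sum>k\<in>K. cnj (G k) / of_real p * G k) = of_real (T / p)"
    unfolding T_def sum_divide_distrib of_real_sum
    by (intro sum.cong) (simp_all add: complex_norm_square flip: of_real_power)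
  finally have "complex_of_real (LINT x|M. (norm (g x - S x))\<^sup>2)
      = of_real (LINT x|M. (norm (g x))\<^sup>2) - of_real (T / p)"
    by (simp add: complex_norm_square[symmetric] del: of_real_power)
  then have "(LINT x|M. (norm (g x - S x))\<^sup>2) = (LINT x|M. (norm (g x))\<^sup>2) - T / p"
    unfolding of_real_diff[symmetric] of_real_eq_iff .
  then have "T = p * (LINT x|M. (norm (g x))\<^sup>2) - p * (LINT x|M. (norm (g x - S x))\<^sup>2)"
    using p by (simp add: field_simps)
  moreover have "p * (LINT x|M. (norm (g x - S x))\<^sup>2) \<ge> 0"
    using p by (intro mult_nonneg_nonneg integral_nonneg_AE) auto
  ultimately have "T \<le> p * (LINT x|M. (norm (g x))\<^sup>2)" by linarith
  then show ?thesis unfolding T_def G_def .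
qed

section \<open>Exponentials of period p and Bessel's inequality for them\<close>

definition per_exp :: "real \<Rightarrow> int \<Rightarrow> real \<Rightarrow> complex" where
  "per_exp p k x = cis (2 * pi * of_int k * x / p)"

lemma norm_per_exp [simp]: "norm (per_exp p k x) = 1"
  by (simp add: per_exp_def)

lemma per_exp_0 [simp]: "per_exp p k 0 = 1" "per_exp p 0 x = 1"
  by (simp_all add: per_exp_def)

lemma continuous_on_per_exp [continuous_intros]: "continuous_on S (per_exp p k)"
  unfolding per_exp_def cis_conv_exp divide_inverse by (intro continuous_intros)

lemma per_exp_measurable [measurable]: "per_exp p k \<in> borel_measurable borel"
  by (intro borel_measurable_continuous_onI continuous_intros)

lemma per_exp_add: "per_exp p k (x + y) = per_exp p k x * per_exp p k y"
  by (simp add: per_exp_def cis_mult distrib_left add_divide_distrib)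

lemma per_exp_mult_cnj: "per_exp p k x * cnj (per_exp p l x) = per_exp p (k - l) x"
  by (simp add: per_exp_def cis_cnj cis_mult diff_divide_distrib algebra_simps)

lemma per_exp_period:
  assumes "p > 0" shows "per_exp p k (of_int m * p) = 1"
proof -
  have "2 * pi * of_int k * (of_int m * p) / p = 2 * pi * of_int (k * m)" using assms by simp
  then show ?thesis unfolding per_exp_def by (simp only:) (rule cis_multiple_2pi, simp)
qed

lemma per_exp_has_vector_derivative:
  "(per_exp p k has_vector_derivative \<i> * (2 * pi * of_int k / p) * per_exp p k x) (at x within S)"
  unfolding per_exp_def cis_conv_exp divide_inverse
  by (auto intro!: derivative_eq_intros has_vector_derivative_real_field simp: algebra_simps)

lemma integral_per_exp:
  assumes "p > 0" shows "integral {0..p} (per_exp p k) = (if k = 0 then of_real p else 0)"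
proof (cases "k = 0")
  case True
  then have "per_exp p k = (\<lambda>_. 1)" by auto
  then show ?thesis using True assms by (simp add: scaleR_conv_of_real)
next
  case False
  define z where "z = \<i> * (2 * pi * of_int k / p)"
  have z: "z \<noteq> 0" using False assms by (simp add: z_def)
  have "(per_exp p k has_integral (per_exp p k p / z - per_exp p k 0 / z)) {0..p}"
  proof (rule fundamental_theorem_of_calculus)
    fix x assume "x \<in> {0..p}"
    have "((\<lambda>x. per_exp p k x / z) has_vector_derivative (z * per_exp p k x) / z) (at x within {0..p})"
      unfolding z_def by (intro has_vector_derivative_divide per_exp_has_vector_derivative)
    then show "((\<lambda>x. per_exp p k x / z) has_vector_derivative per_exp p k x) (at x within {0..p})"
      using z by simp
  qed (use assms in simp)
  moreover have "per_exp p k p = 1" using per_exp_period[OF assms, of k 1] by simp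
  ultimately show ?thesis using False by (simp add: integral_unique)
qed

text \<open>Bessel's inequality lives on a finite measure, while the Fourier coefficients are gauge
  integrals; for continuous integrands the two agree.\<close>

lemma lint_restrict_Icc:
  fixes f :: "real \<Rightarrow> 'a::euclidean_space"
  assumes "continuous_on {a..b} f"
  shows "integral\<^sup>L (restrict_space lborel {a..b}) f = integral {a..b} f"
  using set_borel_integral_eq_integral(2)[OF borel_integrable_atLeastAtMost'[OF assms]]
  by (simp add: integral_restrict_space set_lebesgue_integral_def)

lemma finite_measure_restrict_Icc: "finite_measure (restrict_space lborel {a..b::real})"
  by (rule finite_measureI) (auto simp: emeasure_restrict_space space_restrict_space emeasure_lborel_Icc_eq)

lemma bessel_per_exp:
  assumes p: "p > 0"
    and g: "g \<in> borel_measurable borel" and gB: "\<And>x. norm (g x) \<le> B"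
    and K: "finite K"
  shows "(\<Sum>k\<in>K. (norm (LINT x|restrict_space lborel {0..p}. g x * cnj (per_exp p k x)))\<^sup>2) \<le> (p * B)\<^sup>2"
proof -
  interpret finite_measure "restrict_space lborel {0..p}" by (rule finite_measure_restrict_Icc)
  let ?M = "restrict_space lborel {0..p}"
  have g' [measurable]: "g \<in> borel_measurable ?M" using g by (simp add: measurable_restrict_space1)
  have meas: "per_exp p k \<in> borel_measurable ?M" for k
    by (simp add: measurable_restrict_space1)
  have B0: "B \<ge> 0" by (rule order_trans[OF norm_ge_zero gB])
  have "(\<Sum>k\<in>K. (norm (LINT x|?M. g x * cnj (per_exp p k x)))\<^sup>2) \<le> p * (LINT x|?M. (norm (g x))\<^sup>2)"
  proof (rule bessel_inequality[OF meas _ _ p g' gB K])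
    show "(LINT x|?M. per_exp p k x * cnj (per_exp p l x)) = (if k = l then of_real p else 0)" for k l
      by (simp add: per_exp_mult_cnj lint_restrict_Icc continuous_on_per_exp integral_per_exp[OF p])
  qed auto
  also have "(LINT x|?M. (norm (g x))\<^sup>2) \<le> (LINT x|?M. B\<^sup>2)"
  proof (rule integral_mono)
    show "integrable ?M (\<lambda>x. (norm (g x))\<^sup>2)"
      by (rule integrable_const_bound[of _ "B\<^sup>2"]) (auto intro!: AE_I2 power_mono gB)
    show "(norm (g x))\<^sup>2 \<le> B\<^sup>2" for x by (intro power_mono gB) auto
  qed auto
  also have "(LINT x|?M. B\<^sup>2) = p * B\<^sup>2"
    using p by (simp add: measure_restrict_space space_restrict_space)
  finally show ?thesis using p by (simp add: power2_eq_square mult_ac mult_left_mono)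
qed

section \<open>Periodic functions, sums over the integers, and a lower bound for an exponential near
  its period\<close>

lemma periodic_plus_of_int_mult:
  fixes \<theta> :: "real \<Rightarrow> 'a"
  assumes "\<And>x. \<theta> (x + p) = \<theta> x"
  shows "\<theta> (x + of_int m * p) = \<theta> x"
proof (induction m rule: int_induct[of _ 0])
  case (step1 i)
  then show ?case using assms[of "x + of_int i * p"] by (simp add: distrib_right add.assoc)
next
  case (step2 i)
  then show ?case using assms[of "x + of_int (i - 1) * p"] by (simp add: algebra_simps)
qed simp

lemma integral_periodic_shift:
  fixes h :: "real \<Rightarrow> 'a::euclidean_space"
  assumes cont: "continuous_on UNIV h" and per: "\<And>x. h (x + p) = h x" and s: "0 \<le> s" "s \<le> p"
  shows "integral {0..p} (\<lambda>x. h (x + s)) = integral {0..p} h"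
proof -
  have i: "h integrable_on {a..b}" for a b
    by (intro integrable_continuous_interval continuous_on_subset[OF cont]) auto
  have sh: "integral {a..b} (\<lambda>x. h (x + c)) = integral {a+c..b+c} h" for a b c
    using integral_shift_real_ivl[of "a+c" c "b+c" h] by simp
  have "integral {0..p} (\<lambda>x. h (x + s)) = integral {s..p+s} h" using sh[of 0 p s] by simp
  also have "\<dots> = integral {s..p} h + integral {p..p+s} h"
    using s by (intro Henstock_Kurzweil_Integration.integral_combine[symmetric] i) auto
  also have "integral {p..p+s} h = integral {0..s} h"
    using sh[of 0 s p] by (simp add: per add.commute)
  also have "integral {s..p} h + integral {0..s} h = integral {0..p} h"
    using s Henstock_Kurzweil_Integration.integral_combine[of 0 s p h] i by (simp add: add.commute)
  finally show ?thesis .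
qed


text \<open>Symmetric intervals eventually contain every finite set. This evaluates sums that are
  already known to exist.\<close>

lemma has_sum_symmetric_limit:
  fixes f :: "int \<Rightarrow> 'a::real_normed_vector"
  assumes "(f has_sum S) UNIV"
  shows "(\<lambda>N. \<Sum>k\<in>{- int N..int N}. f k) \<longlonglongrightarrow> S"
proof -
  have "filterlim (\<lambda>N. {- int N..int N}) (finite_subsets_at_top UNIV) sequentially"
    unfolding filterlim_finite_subsets_at_top
  proof safe
    fix X :: "int set" assume X: "finite X"
    show "\<forall>\<^sub>F N in sequentially. finite {- int N..int N} \<and> X \<subseteq> {- int N..int N} \<and> {- int N..int N} \<subseteq> UNIV"
    \<comment> \<open>The sum of |k| over X bounds every |k| with k in X at once.\<close>
    proof (rule eventually_sequentiallyI[of "nat (\<Sum>k\<in>X. \<bar>k\<bar>)"], safe)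
      fix N k assume "nat (\<Sum>k\<in>X. \<bar>k\<bar>) \<le> N" "k \<in> X"
      moreover from this have "\<bar>k\<bar> \<le> (\<Sum>k\<in>X. \<bar>k\<bar>)" using X by (intro member_le_sum) auto
      ultimately show "k \<in> {- int N..int N}" by auto
    qed auto
  qed
  then show ?thesis using assms unfolding has_sum_def by (rule filterlim_compose[rotated])
qed

text \<open>The nonnegative and the negative indices inject separately into the naturals by |k|.
  Index 0 is harmless, as both quotients are 0 there by convention.\<close>

lemma bdd_sum_inverse_squares_int:
  assumes "finite (K :: int set)"
  shows "(\<Sum>k\<in>K. 1 / (of_int k)\<^sup>2) \<le> 2 * (\<Sum>n. inverse ((real n)\<^sup>2))"
proof -
  let ?S = "\<Sum>n. inverse ((real n)\<^sup>2)"
  have sm: "summable (\<lambda>n. inverse ((real n)\<^sup>2))" by (rule inverse_power_summable) simp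
  have inj: "(\<Sum>k\<in>K'. 1 / (of_int k)\<^sup>2) \<le> ?S" if "finite K'" "inj_on (\<lambda>k. nat \<bar>k\<bar>) K'" for K' :: "int set"
  proof -
    have "(\<Sum>k\<in>K'. 1 / (of_int k)\<^sup>2) = (\<Sum>n\<in>(\<lambda>k. nat \<bar>k\<bar>) ` K'. inverse ((real n)\<^sup>2))"
      unfolding sum.reindex[OF that(2)] by (intro sum.cong) (auto simp: inverse_eq_divide)
    also have "\<dots> \<le> ?S" by (intro sum_le_suminf sm) (use that in auto)
    finally show ?thesis .
  qed
  have "K = {k\<in>K. k \<ge> 0} \<union> {k\<in>K. k < 0}" by auto
  then have "(\<Sum>k\<in>K. 1 / (real_of_int k)\<^sup>2) = (\<Sum>k\<in>{k\<in>K. k \<ge> 0}. 1 / (of_int k)\<^sup>2) + (\<Sum>k\<in>{k\<in>K. k < 0}. 1 / (of_int k)\<^sup>2)"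
    using assms by (subst sum.union_disjoint[symmetric]) auto
  also have "\<dots> \<le> ?S + ?S" by (intro add_mono inj) (use assms in \<open>auto simp: inj_on_def\<close>)
  finally show ?thesis by simp
qed

text \<open>A crude form of Jordan's inequality: |sin x - x| \<le> x^3 / 6, and x \<le> 2, which
  follows from \<pi> < 4, gives x^3 / 6 \<le> 2 x / 3.\<close>

lemma sin_ge_third:
  assumes "0 \<le> x" "x \<le> pi / 2" shows "sin x \<ge> x / 3"
proof -
  have x2: "x \<le> 2" using assms pi_less_4 by simp
  have "\<bar>sin x - x\<bar> \<le> x ^ 3 / 6"
    using Maclaurin_sin_bound[of x 3] assms
    by (simp add: numeral_3_eq_3 sin_coeff_def fact_numeral)
  moreover have "x ^ 3 \<le> 4 * x"
  proof -
    have "x * x \<le> 2 * 2" using x2 assms by (intro mult_mono) auto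
    from mult_right_mono[OF this assms(1)] show ?thesis by (simp add: power3_eq_cube)
  qed
  ultimately show ?thesis by linarith
qed

text \<open>The left-hand side is 2 |sin (\<pi> t / p)|, symmetric about p / 2, so t may be replaced
  by its distance to the nearer end point; \<pi> > 3 absorbs the factor 1/3. In effect the zeros at
  0 and p are simple, so a Lipschitz numerator can be divided by this expression.\<close>

lemma norm_per_exp_1_minus_1_ge:
  assumes p: "p > 0" and t: "0 \<le> t" "t \<le> p"
  shows "norm (per_exp p 1 t - 1) \<ge> min t (p - t) / p"
proof -
  have "per_exp p 1 t - 1 = cis (pi * t / p) * (cis (pi * t / p) - cis (- (pi * t / p)))"
    by (simp add: per_exp_def cis_mult right_diff_distrib mult.assoc)
  also have "cis (pi * t / p) - cis (- (pi * t / p)) = 2 * \<i> * of_real (sin (pi * t / p))"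
    by (simp add: complex_eq_iff)
  finally have n: "norm (per_exp p 1 t - 1) = 2 * \<bar>sin (pi * t / p)\<bar>"
    by (simp add: norm_mult)
  define m where "m = min t (p - t)"
  have m: "0 \<le> m" "m \<le> p / 2" using t by (auto simp: m_def min_def)
  have "sin (pi * t / p) = sin (pi * m / p)"
  proof (cases "t \<le> p - t")
    case False
    have "sin (pi * m / p) = sin (pi - pi * t / p)"
      using False p by (simp add: m_def min_def diff_divide_distrib right_diff_distrib)
    then show ?thesis by simp
  qed (simp add: m_def)
  moreover have "sin (pi * m / p) \<ge> (pi * m / p) / 3"
    using m p by (intro sin_ge_third) (auto simp: field_simps)
  moreover have "(pi * m / p) / 3 \<ge> m / p"
  proof -
    have "3 * (m / p) \<le> pi * (m / p)" using m p pi_gt3 by (intro mult_right_mono) auto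
    then show ?thesis by simp
  qed
  moreover have "m / p \<ge> 0" using m p by simp
  ultimately show ?thesis unfolding n m_def[symmetric] by linarith
qed

text \<open>Steps are restricted to one period because this form of the bound follows from a
  Lipschitz bound on two adjacent periods by reducing x modulo p.\<close>

locale lipschitz_periodic =
  fixes \<theta> :: "real \<Rightarrow> real" and p L :: real
  assumes p: "p > 0" and per: "\<And>x. \<theta> (x + p) = \<theta> x" and cont: "continuous_on UNIV \<theta>"
    and lip: "\<And>x s. 0 \<le> s \<Longrightarrow> s \<le> p \<Longrightarrow> \<bar>\<theta> (x + s) - \<theta> x\<bar> \<le> L * s"
begin

definition coeff :: "int \<Rightarrow> complex" where
  "coeff k = integral {0..p} (\<lambda>x. of_real (\<theta> x) * cnj (per_exp p k x)) / of_real p"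

lemma L_nonneg: "L \<ge> 0"
  using lip[of p 0] p by (smt (verit) zero_le_mult_iff abs_ge_zero)

lemma continuous_on_complex: "continuous_on S (\<lambda>x. complex_of_real (\<theta> (x + s)))"
  by (intro continuous_intros continuous_on_compose2[OF cont]) auto

lemma measurable_theta [measurable]: "\<theta> \<in> borel_measurable borel"
  using cont by (rule borel_measurable_continuous_onI)

text \<open>Writing the exponential in terms of x + s takes a phase out of the integral; what
  remains has period p, so its window can be shifted back.\<close>

lemma integral_shifted:
  assumes "0 \<le> s" "s \<le> p"
  shows "integral {0..p} (\<lambda>x. of_real (\<theta> (x + s)) * cnj (per_exp p k x)) = per_exp p k s * (of_real p * coeff k)"
proof -
  define h where "h x = complex_of_real (\<theta> x) * cnj (per_exp p k x)" for x
  have e: "of_real (\<theta> (x + s)) * cnj (per_exp p k x) = per_exp p k s * h (x + s)" for x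
    using per_exp_mult_cnj[of p k s k] by (simp add: h_def per_exp_add mult_ac)
  have ph: "h (x + p) = h x" for x
    using per_exp_period[OF p, of k 1] by (simp add: h_def per per_exp_add)
  have ch: "continuous_on UNIV h"
    unfolding h_def using continuous_on_complex[of UNIV 0]
    by (intro continuous_intros) simp
  have "integral {0..p} (\<lambda>x. h (x + s)) = integral {0..p} h"
    by (rule integral_periodic_shift[OF ch ph assms])
  also have "\<dots> = of_real p * coeff k" using p by (simp add: coeff_def h_def[abs_def])
  finally show ?thesis unfolding e by simp
qed

lemma integral_difference:
  assumes "0 \<le> s" "s \<le> p"
  shows "(LINT x|restrict_space lborel {0..p}. of_real (\<theta> (x + s) - v) * cnj (per_exp p k x))
    = per_exp p k s * (of_real p * coeff k) - (if k = 0 then of_real (p * v) else 0)"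
proof -
  have c1: "continuous_on {0..p} (\<lambda>x. of_real (\<theta> (x + s)) * cnj (per_exp p k x))"
    by (intro continuous_intros continuous_on_complex)
  have c2: "continuous_on {0..p} (\<lambda>x. of_real v * per_exp p (- k) x)"
    by (intro continuous_intros)
  have e: "of_real (\<theta> (x + s) - v) * cnj (per_exp p k x)
      = of_real (\<theta> (x + s)) * cnj (per_exp p k x) - of_real v * per_exp p (- k) x" for x
    using per_exp_mult_cnj[of p 0 x k] by (simp add: algebra_simps)
  have "(LINT x|restrict_space lborel {0..p}. of_real (\<theta> (x + s) - v) * cnj (per_exp p k x))
      = integral {0..p} (\<lambda>x. of_real (\<theta> (x + s)) * cnj (per_exp p k x) - of_real v * per_exp p (- k) x)"
    unfolding e by (intro lint_restrict_Icc continuous_on_diff c1 c2)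
  also have "\<dots> = integral {0..p} (\<lambda>x. of_real (\<theta> (x + s)) * cnj (per_exp p k x))
      - integral {0..p} (\<lambda>x. of_real v * per_exp p (- k) x)"
    by (intro Henstock_Kurzweil_Integration.integral_diff integrable_continuous_interval c1 c2)
  finally show ?thesis by (simp add: integral_shifted[OF assms] integral_per_exp[OF p])
qed

text \<open>Bessel's inequality for the derivative without differentiating \<theta>: the quotient
  (\<theta> (x + s) - \<theta> x) / s is bounded by L and has coefficients c_k
  (\<open>per_exp p k s\<close> - 1) / s, which tend to c_k times 2 \<pi> i k / p as s falls to 0.
  Hence finite sums of k^2 |c_k|^2 are bounded, and |c_k| \<le> k^2 |c_k|^2 + 1 / k^2 for k
  different from 0.\<close>

lemma abs_summable_coeff: "(\<lambda>k. norm (coeff k)) summable_on UNIV"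
proof -
  have weighted: "(\<Sum>k\<in>K. (norm (coeff k))\<^sup>2 * (2 * pi * of_int k / p)\<^sup>2) \<le> L\<^sup>2" if K: "finite K" for K
  proof (rule tendsto_upperbound)
    show "((\<lambda>s. \<Sum>k\<in>K. (norm (coeff k))\<^sup>2 * (norm ((per_exp p k s - 1) /\<^sub>R s))\<^sup>2)
        \<longlongrightarrow> (\<Sum>k\<in>K. (norm (coeff k))\<^sup>2 * (2 * pi * of_int k / p)\<^sup>2)) (at_right 0)"
    proof (intro tendsto_sum tendsto_mult tendsto_const)
      fix k
      have "((\<lambda>s. (per_exp p k s - 1) /\<^sub>R s) \<longlongrightarrow> \<i> * (2 * pi * of_int k / p)) (at_right 0)"
      proof -
        define z where "z = \<i> * (2 * pi * of_int k / p)"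
        have "((\<lambda>y. norm (per_exp p k y - 1 - y *\<^sub>R z) / norm y) \<longlongrightarrow> 0) (at_right 0)"
          using per_exp_has_vector_derivative[of p k 0 "{0<..}"]
          unfolding has_vector_derivative_def has_derivative_iff_norm by (simp add: z_def)
        moreover have "\<forall>\<^sub>F y in at_right 0. norm (per_exp p k y - 1 - y *\<^sub>R z) / norm y
            = norm ((per_exp p k y - 1) /\<^sub>R y - z)"
          unfolding eventually_at_filter
        proof (intro always_eventually allI impI)
          fix y :: real assume "y \<noteq> 0" "y \<in> {0<..}"
          then have "(per_exp p k y - 1) /\<^sub>R y - z = (per_exp p k y - 1 - y *\<^sub>R z) /\<^sub>R y"
            by (simp add: scaleR_diff_right)
          then show "norm (per_exp p k y - 1 - y *\<^sub>R z) / norm y = norm ((per_exp p k y - 1) /\<^sub>R y - z)"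
            by (simp add: divide_inverse mult.commute)
        qed
        ultimately have "((\<lambda>y. norm ((per_exp p k y - 1) /\<^sub>R y - z)) \<longlongrightarrow> 0) (at_right 0)"
          by (rule Lim_transform_eventually)
        then show ?thesis unfolding z_def[symmetric] by (rule LIM_zero_cancel[OF tendsto_norm_zero_cancel])
      qed
      from tendsto_power[OF tendsto_norm[OF this], of 2]
      show "((\<lambda>s. (norm ((per_exp p k s - 1) /\<^sub>R s))\<^sup>2) \<longlongrightarrow> (2 * pi * of_int k / p)\<^sup>2) (at_right 0)"
        by (simp add: norm_mult norm_divide power_mult_distrib power_divide)
    qed
    have "(\<Sum>k\<in>K. (norm (coeff k))\<^sup>2 * (norm ((per_exp p k s - 1) /\<^sub>R s))\<^sup>2) \<le> L\<^sup>2"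
      if s: "0 < s" "s < p" for s
    proof -
      let ?G = "\<lambda>k. LINT x|restrict_space lborel {0..p}. of_real (\<theta> (x + s) - \<theta> x) * cnj (per_exp p k x)"
      have G: "?G k = (per_exp p k s - 1) * (of_real p * coeff k)" for k
      proof -
        let ?M = "restrict_space lborel {0..p}"
        have c: "continuous_on {0..p} (\<lambda>x. of_real (\<theta> (x + t)) * cnj (per_exp p k x))" for t
          by (intro continuous_intros continuous_on_complex)
        have "?G k = integral {0..p} (\<lambda>x. of_real (\<theta> (x + s)) * cnj (per_exp p k x) - of_real (\<theta> (x + 0)) * cnj (per_exp p k x))"
          using lint_restrict_Icc[OF continuous_on_diff[OF c[of s] c[of 0]]] by (simp add: left_diff_distrib)
        also have "\<dots> = per_exp p k s * (of_real p * coeff k) - per_exp p k 0 * (of_real p * coeff k)"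
          using s by (subst Henstock_Kurzweil_Integration.integral_diff, intro integrable_continuous_interval c)
            (intro integrable_continuous_interval c, subst (1 2) integral_shifted, auto)
        finally show ?thesis by (simp add: left_diff_distrib)
      qed
      have scale: "(norm (d * (of_real p * c)))\<^sup>2 = (p * s)\<^sup>2 * ((norm c)\<^sup>2 * (norm (d /\<^sub>R s))\<^sup>2)"
        for c d :: complex
      proof -
        have "norm (d /\<^sub>R s) = norm d / s" using s by (simp add: divide_inverse mult.commute)
        then show ?thesis using s p by (simp add: norm_mult power_mult_distrib power_divide)
      qed
      have "(\<Sum>k\<in>K. (norm (?G k))\<^sup>2) \<le> (p * (L * s))\<^sup>2"
        by (rule bessel_per_exp[OF p _ _ K]) (use s lip[of s] in \<open>auto simp flip: of_real_diff\<close>)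
      also have "(\<Sum>k\<in>K. (norm (?G k))\<^sup>2)
          = (p * s)\<^sup>2 * (\<Sum>k\<in>K. (norm (coeff k))\<^sup>2 * (norm ((per_exp p k s - 1) /\<^sub>R s))\<^sup>2)"
        unfolding sum_distrib_left G using s
        by (intro sum.cong refl scale)
      also have "(p * (L * s))\<^sup>2 = (p * s)\<^sup>2 * L\<^sup>2" by (simp add: power_mult_distrib)
      finally show ?thesis using s p by (simp add: zero_less_mult_iff)
    qed
    then show "\<forall>\<^sub>F s in at_right 0. (\<Sum>k\<in>K. (norm (coeff k))\<^sup>2 * (norm ((per_exp p k s - 1) /\<^sub>R s))\<^sup>2) \<le> L\<^sup>2"
      using p by (auto simp: eventually_at_right[OF p])
  qed simp
  \<comment> \<open>The weight k^2 vanishes at k = 0, so the mean is kept as a separate term; the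
    factor (p / (2 \<pi>))^2 undoes the scaling in \<open>weighted\<close>.\<close>
  define A where "A = norm (coeff 0) + (p / (2 * pi))\<^sup>2 * L\<^sup>2 + 2 * (\<Sum>n. inverse ((real n)\<^sup>2))"
  have bnd: "sum (\<lambda>k. norm (coeff k)) K \<le> A" if K: "finite K" for K
  proof -
    have le: "norm (coeff k) \<le> (if k = 0 then norm (coeff 0) else 0)
        + ((p / (2 * pi))\<^sup>2 * ((norm (coeff k))\<^sup>2 * (2 * pi * of_int k / p)\<^sup>2) + 1 / (of_int k)\<^sup>2)" for k
    proof (cases "k = 0")
      case False
      \<comment> \<open>Inequality of arithmetic and geometric means for |c_k| |k| and 1 / |k|,
        whose product is |c_k|.\<close>
      have "0 \<le> (norm (coeff k) * \<bar>of_int k\<bar> - 1 / \<bar>of_int k\<bar>)\<^sup>2" by simp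
      also have "\<dots> = (norm (coeff k))\<^sup>2 * (of_int k)\<^sup>2 - 2 * norm (coeff k) + 1 / (of_int k)\<^sup>2"
        using False by (simp add: power2_diff power_mult_distrib power_divide)
      finally have "2 * norm (coeff k) \<le> (norm (coeff k))\<^sup>2 * (of_int k)\<^sup>2 + 1 / (of_int k)\<^sup>2" by simp
      moreover have "norm (coeff k) \<ge> 0" by simp
      ultimately have "norm (coeff k) \<le> (norm (coeff k))\<^sup>2 * (of_int k)\<^sup>2 + 1 / (of_int k)\<^sup>2" by linarith
      moreover have "(p / (2 * pi))\<^sup>2 * ((norm (coeff k))\<^sup>2 * (2 * pi * of_int k / p)\<^sup>2) = (norm (coeff k))\<^sup>2 * (of_int k)\<^sup>2"
        using p by (simp add: power_divide power_mult_distrib)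
      ultimately show ?thesis unfolding if_not_P[OF False] by linarith
    qed auto
    have "sum (\<lambda>k. norm (coeff k)) K \<le> (\<Sum>k\<in>K. (if k = 0 then norm (coeff 0) else 0)
        + ((p / (2 * pi))\<^sup>2 * ((norm (coeff k))\<^sup>2 * (2 * pi * of_int k / p)\<^sup>2) + 1 / (of_int k)\<^sup>2))"
      by (intro sum_mono le)
    also have "\<dots> = (\<Sum>k\<in>K. if k = 0 then norm (coeff 0) else 0)
        + ((p / (2 * pi))\<^sup>2 * (\<Sum>k\<in>K. (norm (coeff k))\<^sup>2 * (2 * pi * of_int k / p)\<^sup>2) + (\<Sum>k\<in>K. 1 / (of_int k)\<^sup>2))"
      by (simp add: sum.distrib sum_distrib_left)
    also have "\<dots> \<le> norm (coeff 0) + ((p / (2 * pi))\<^sup>2 * L\<^sup>2 + 2 * (\<Sum>n. inverse ((real n)\<^sup>2)))"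
      using K by (intro add_mono mult_left_mono weighted bdd_sum_inverse_squares_int)
        (auto simp: sum.delta)
    also have "\<dots> = A" by (simp add: A_def)
    finally show ?thesis .
  qed
  show ?thesis
    by (rule nonneg_bdd_above_summable_on) (use bnd in \<open>auto simp: bdd_above_def\<close>)
qed


text \<open>Chernoff's argument: dividing \<open>\<theta> (x + t) - \<theta> x\<close> by \<open>per_exp p 1 t - 1\<close> turns the symmetric
  partial sums of the Fourier series at \<open>x\<close> into telescoping sums of Fourier coefficients of a
  bounded function.\<close>

lemma fourier_series_base:
  assumes x: "0 \<le> x" "x \<le> p"
  shows "((\<lambda>k. coeff k * per_exp p k x) has_sum of_real (\<theta> x)) UNIV"
proof -
  define g where "g t = (if 0 \<le> t \<and> t \<le> p then of_real (\<theta> (t + x) - \<theta> x) / (per_exp p 1 t - 1) else 0)" for t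
  define M where "M = restrict_space lborel {0..p}"
  interpret M: finite_measure M unfolding M_def by (rule finite_measure_restrict_Icc)
  have g_meas: "g \<in> borel_measurable borel" unfolding g_def by measurable
  have gB: "norm (g t) \<le> L * p" for t
  proof (cases "0 \<le> t \<and> t \<le> p")
    case True
    have "\<bar>\<theta> (t + x) - \<theta> x\<bar> \<le> L * t" using lip[of t x] True by (simp add: add.commute)
    \<comment> \<open>Near the other end the increment is taken from t + x up to x + p, where
      \<theta> has the value \<theta> x again.\<close>
    moreover have "\<bar>\<theta> (t + x) - \<theta> x\<bar> \<le> L * (p - t)"
      using lip[of "p - t" "t + x"] True per[of x] by (simp add: algebra_simps abs_minus_commute)
    ultimately have "norm (complex_of_real (\<theta> (t + x) - \<theta> x)) \<le> L * min t (p - t)"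
      unfolding norm_of_real min_def by simp
    also have "\<dots> = L * p * (min t (p - t) / p)" using p by simp
    also have "\<dots> \<le> L * p * norm (per_exp p 1 t - 1)"
      using norm_per_exp_1_minus_1_ge[OF p, of t] True L_nonneg p by (intro mult_left_mono) auto
    finally have "norm (complex_of_real (\<theta> (t + x) - \<theta> x)) \<le> L * p * norm (per_exp p 1 t - 1)" .
    then show ?thesis using True L_nonneg p
      by (cases "per_exp p 1 t = 1") (auto simp: g_def norm_divide divide_le_eq simp del: of_real_diff)
  qed (use L_nonneg p in \<open>auto simp: g_def\<close>)
  \<comment> \<open>At the zeros t = 0 and t = p of the denominator the quotient is 0 by convention.
    The numerator vanishes there by periodicity, so the identity has no exceptional points.\<close>
  have g_eq: "of_real (\<theta> (t + x) - \<theta> x) = g t * (per_exp p 1 t - 1)" if "0 \<le> t" "t \<le> p" for t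
  proof (cases "per_exp p 1 t = 1")
    case True
    then have "min t (p - t) / p \<le> 0" using norm_per_exp_1_minus_1_ge[OF p that] by simp
    then have "t = 0 \<or> t = p" using p that by (auto simp: divide_le_0_iff min_def split: if_splits)
    then have "\<theta> (t + x) = \<theta> x" using per[of x] by (auto simp: add.commute)
    then show ?thesis using True by simp
  qed (use that in \<open>simp add: g_def\<close>)
  define G where "G k = (LINT t|M. g t * cnj (per_exp p k t))" for k
  have int_g: "integrable M (\<lambda>t. g t * cnj (per_exp p k t))" for k
  proof (rule M.integrable_const_bound[of _ "L * p"])
    have "(\<lambda>t. g t * per_exp p (- k) t) \<in> borel_measurable M"
      unfolding M_def using g_meas per_exp_measurable[of p "- k"]
      by (intro measurable_restrict_space1) simp
    moreover have "cnj (per_exp p k t) = per_exp p (- k) t" for t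
      using per_exp_mult_cnj[of p 0 t k] by simp
    ultimately show "(\<lambda>t. g t * cnj (per_exp p k t)) \<in> borel_measurable M" by simp
  qed (use gB in \<open>auto simp: norm_mult\<close>)
  \<comment> \<open>Multiplication by \<open>per_exp p 1\<close> shifts the index of a coefficient
    by 1; the subtracted constant \<theta> x affects mode 0 only.\<close>
  have tele: "per_exp p k x * (of_real p * coeff k) - (if k = 0 then of_real (p * \<theta> x) else 0) = G (k - 1) - G k" for k
  proof -
    have "(LINT t|M. of_real (\<theta> (t + x) - \<theta> x) * cnj (per_exp p k t))
        = (LINT t|M. g t * cnj (per_exp p (k - 1) t) - g t * cnj (per_exp p k t))"
    proof (rule Bochner_Integration.integral_cong)
      fix t assume "t \<in> space M"
      then have t: "0 \<le> t" "t \<le> p" by (auto simp: M_def space_restrict_space)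
      have c: "cnj (per_exp p l t) = per_exp p (- l) t" for l
        using per_exp_mult_cnj[of p 0 t l] by simp
      have "per_exp p 1 t * cnj (per_exp p k t) = cnj (per_exp p (k - 1) t)"
        using per_exp_mult_cnj[of p 1 t k] c[of "k - 1"] by simp
      then show "of_real (\<theta> (t + x) - \<theta> x) * cnj (per_exp p k t) = g t * cnj (per_exp p (k - 1) t) - g t * cnj (per_exp p k t)"
        unfolding g_eq[OF t] by (simp add: algebra_simps)
    qed simp
    also have "\<dots> = G (k - 1) - G k"
      unfolding G_def by (intro Bochner_Integration.integral_diff int_g)
    finally show ?thesis using integral_difference[OF x, of "\<theta> x" k] by (simp add: M_def)
  qed
  have sums: "(\<Sum>k\<in>{- int N..int N}. of_real p * (coeff k * per_exp p k x)) - of_real (p * \<theta> x)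
      = G (- int (Suc N)) - G (int N)" for N
  proof -
    have "(\<Sum>k\<in>{- int N..int N}. G (k - 1) - G k) = G (- int (Suc N)) - G (int N)"
    proof (induction N)
      case (Suc N)
      have "{- int (Suc N)..int (Suc N)} = insert (- int (Suc N)) (insert (int (Suc N)) {- int N..int N})"
        by auto
      then show ?case using Suc by (simp add: algebra_simps)
    qed simp
    moreover have "(\<Sum>k\<in>{- int N..int N}. G (k - 1) - G k)
        = (\<Sum>k\<in>{- int N..int N}. of_real p * (coeff k * per_exp p k x) - (if k = 0 then of_real (p * \<theta> x) else 0))"
      unfolding tele[symmetric] by (simp add: mult_ac)
    moreover have "\<dots> = (\<Sum>k\<in>{- int N..int N}. of_real p * (coeff k * per_exp p k x)) - of_real (p * \<theta> x)"
      unfolding sum_subtractf by (simp add: sum.delta)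
    ultimately show ?thesis by simp
  qed
  \<comment> \<open>The Riemann-Lebesgue lemma for the bounded function g, from Bessel: the squares
    are summable. The values 1 and -1 of \<sigma> cover both ends of the telescoped sum.\<close>
  have G_lim: "(\<lambda>N. G (\<sigma> * int N)) \<longlonglongrightarrow> 0" if \<sigma>: "\<sigma> \<noteq> 0" for \<sigma>
  proof -
    have "summable (\<lambda>N. (norm (G (\<sigma> * int N)))\<^sup>2)"
    proof (rule bounded_imp_summable)
      fix N
      have "(\<Sum>k\<le>N. (norm (G (\<sigma> * int k)))\<^sup>2) = (\<Sum>k\<in>(\<lambda>k. \<sigma> * int k) ` {..N}. (norm (G k))\<^sup>2)"
        by (subst sum.reindex) (use \<sigma> in \<open>auto simp: inj_on_def\<close>)
      also have "\<dots> \<le> (p * (L * p))\<^sup>2"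
        unfolding G_def M_def by (rule bessel_per_exp[OF p g_meas gB]) simp
      finally show "(\<Sum>k\<le>N. (norm (G (\<sigma> * int k)))\<^sup>2) \<le> (p * (L * p))\<^sup>2" .
    qed simp
    from summable_LIMSEQ_zero[OF this] have "(\<lambda>N. sqrt ((norm (G (\<sigma> * int N)))\<^sup>2)) \<longlonglongrightarrow> sqrt 0"
      by (rule tendsto_real_sqrt)
    then show ?thesis by (simp add: tendsto_norm_zero_iff)
  qed
  have "(\<lambda>N. G (- int (Suc N)) - G (int N)) \<longlonglongrightarrow> 0 - 0"
    using LIMSEQ_Suc[OF G_lim[of "-1"]] G_lim[of 1] by (intro tendsto_diff) auto
  then have lim1: "(\<lambda>N. (\<Sum>k\<in>{- int N..int N}. of_real p * (coeff k * per_exp p k x)) - of_real (p * \<theta> x)) \<longlonglongrightarrow> 0"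
    unfolding sums by simp
  \<comment> \<open>Absolute summability provides the unconditional sum S; the symmetric limit then
    only determines its value.\<close>
  have "(\<lambda>k. coeff k * per_exp p k x) summable_on UNIV"
    by (rule abs_summable_summable) (use abs_summable_coeff in \<open>simp add: norm_mult\<close>)
  then obtain S where S: "((\<lambda>k. coeff k * per_exp p k x) has_sum S) UNIV"
    by (auto simp: summable_on_def)
  from has_sum_symmetric_limit[OF has_sum_cmult_right[OF S, of "of_real p"]]
  have "(\<lambda>N. \<Sum>k\<in>{- int N..int N}. of_real p * (coeff k * per_exp p k x)) \<longlonglongrightarrow> of_real p * S" .
  from LIMSEQ_unique[OF tendsto_diff[OF this tendsto_const] lim1]
  have "of_real p * S = of_real (p * \<theta> x)" by simp
  then have "S = of_real (\<theta> x)" using p by simp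
  then show ?thesis using S by simp
qed

lemma fourier_series: "((\<lambda>k. coeff k * per_exp p k x) has_sum of_real (\<theta> x)) UNIV"
proof -
  define m where "m = \<lfloor>x / p\<rfloor>"
  define y where "y = x - of_int m * p"
  have y: "0 \<le> y" "y \<le> p"
    using floor_divide_lower[OF p, of x] floor_divide_upper[OF p, of x]
    by (auto simp: y_def m_def algebra_simps)
  have xy: "x = y + of_int m * p" by (simp add: y_def)
  have "\<theta> x = \<theta> y" unfolding xy by (rule periodic_plus_of_int_mult) (rule per)
  moreover have "per_exp p k x = per_exp p k y" for k
    by (simp add: xy per_exp_add per_exp_period[OF p])
  ultimately show ?thesis using fourier_series_base[OF y] by simp
qed

end

text \<open>Induction on the break points. An interior point q splits the interval; both halves
  contain q, so their bounds combine by the triangle inequality through q with the larger constant.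
  A point outside the open interval splits nothing and is dropped.\<close>

lemma piecewise_lipschitz:
  fixes \<theta> :: "real \<Rightarrow> real"
  assumes "finite S" "a \<le> b"
    and "\<And>s t. a \<le> s \<Longrightarrow> s < t \<Longrightarrow> t \<le> b \<Longrightarrow> {s<..<t} \<inter> S = {} \<Longrightarrow>
      \<exists>L. \<forall>x\<in>{s..t}. \<forall>y\<in>{s..t}. \<bar>\<theta> x - \<theta> y\<bar> \<le> L * \<bar>x - y\<bar>"
  shows "\<exists>L. \<forall>x\<in>{a..b}. \<forall>y\<in>{a..b}. \<bar>\<theta> x - \<theta> y\<bar> \<le> L * \<bar>x - y\<bar>"
  using assms
proof (induction arbitrary: a b rule: finite_induct)
  case empty
  show ?case
  proof (cases "a = b")
    case False
    then show ?thesis using empty by simp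
  qed auto
next
  case (insert q S)
  show ?case
  proof (cases "a < q \<and> q < b")
    case False
    show ?thesis
    proof (rule insert.IH[OF insert.prems(1)])
      fix s t assume st: "a \<le> s" "s < t" "t \<le> b" "{s<..<t} \<inter> S = {}"
      have "{s<..<t} \<inter> insert q S = {}" using st False by auto
      then show "\<exists>L. \<forall>x\<in>{s..t}. \<forall>y\<in>{s..t}. \<bar>\<theta> x - \<theta> y\<bar> \<le> L * \<bar>x - y\<bar>"
        using insert.prems(2) st by blast
    qed
  next
    case True
    have "\<exists>L. \<forall>x\<in>{a..q}. \<forall>y\<in>{a..q}. \<bar>\<theta> x - \<theta> y\<bar> \<le> L * \<bar>x - y\<bar>"
    proof (rule insert.IH)
      fix s t assume st: "a \<le> s" "s < t" "t \<le> q" "{s<..<t} \<inter> S = {}"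
      then have "{s<..<t} \<inter> insert q S = {}" "t \<le> b" using True by auto
      then show "\<exists>L. \<forall>x\<in>{s..t}. \<forall>y\<in>{s..t}. \<bar>\<theta> x - \<theta> y\<bar> \<le> L * \<bar>x - y\<bar>"
        using insert.prems(2) st by blast
    qed (use True in auto)
    then obtain L1 where L1: "\<And>x y. x \<in> {a..q} \<Longrightarrow> y \<in> {a..q} \<Longrightarrow> \<bar>\<theta> x - \<theta> y\<bar> \<le> L1 * \<bar>x - y\<bar>" by blast
    have "\<exists>L. \<forall>x\<in>{q..b}. \<forall>y\<in>{q..b}. \<bar>\<theta> x - \<theta> y\<bar> \<le> L * \<bar>x - y\<bar>"
    proof (rule insert.IH)
      fix s t assume st: "q \<le> s" "s < t" "t \<le> b" "{s<..<t} \<inter> S = {}"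
      then have "{s<..<t} \<inter> insert q S = {}" "a \<le> s" using True by auto
      then show "\<exists>L. \<forall>x\<in>{s..t}. \<forall>y\<in>{s..t}. \<bar>\<theta> x - \<theta> y\<bar> \<le> L * \<bar>x - y\<bar>"
        using insert.prems(2) st by blast
    qed (use True in auto)
    then obtain L2 where L2: "\<And>x y. x \<in> {q..b} \<Longrightarrow> y \<in> {q..b} \<Longrightarrow> \<bar>\<theta> x - \<theta> y\<bar> \<le> L2 * \<bar>x - y\<bar>" by blast
    define L where "L = max L1 L2"
    have le: "L1 * \<bar>z\<bar> \<le> L * \<bar>z\<bar>" "L2 * \<bar>z\<bar> \<le> L * \<bar>z\<bar>" for z
      by (auto simp: L_def intro: mult_right_mono)
    have main: "\<bar>\<theta> x - \<theta> y\<bar> \<le> L * \<bar>x - y\<bar>" if "x \<in> {a..b}" "y \<in> {a..b}" "x \<le> y" for x y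
    proof -
      consider "y \<le> q" | "q \<le> x" | "x \<le> q" "q \<le> y" by linarith
      then show ?thesis
      proof cases
        case 1
        then show ?thesis using L1[of x y] le(1)[of "x - y"] that by auto
      next
        case 2
        then show ?thesis using L2[of x y] le(2)[of "x - y"] that by auto
      next
        case 3
        have "\<bar>\<theta> x - \<theta> q\<bar> \<le> L * (q - x)" using L1[of x q] le(1)[of "x - q"] that 3 True by auto
        moreover have "\<bar>\<theta> q - \<theta> y\<bar> \<le> L * (y - q)" using L2[of q y] le(2)[of "q - y"] that 3 True by auto
        ultimately have "\<bar>\<theta> x - \<theta> y\<bar> \<le> L * (q - x) + L * (y - q)" by linarith
        also have "\<dots> = L * \<bar>x - y\<bar>" using 3 by (simp add: algebra_simps)
        finally show ?thesis .
      qed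
    qed
    have "\<bar>\<theta> x - \<theta> y\<bar> \<le> L * \<bar>x - y\<bar>" if "x \<in> {a..b}" "y \<in> {a..b}" for x y
      using main[of x y] main[of y x] that by (cases "x \<le> y") (auto simp: abs_minus_commute)
    then show ?thesis by blast
  qed
qed

text \<open>The derivative is continuous up to the end points of the closed piece, hence bounded by
  compactness.\<close>

lemma cont_diff_on_Icc_lipschitz:
  assumes "cont_diff_on_Icc g s t"
  shows "\<exists>L. \<forall>x\<in>{s..t}. \<forall>y\<in>{s..t}. \<bar>g x - g y\<bar> \<le> L * \<bar>x - y\<bar>"
proof -
  obtain g' where g': "continuous_on {s..t} g'"
    "\<And>x. x \<in> {s..t} \<Longrightarrow> (g has_real_derivative g' x) (at x within {s..t})"
    using assms by (auto simp: cont_diff_on_Icc_def)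
  have "bounded (g' ` {s..t})" using compact_continuous_image[OF g'(1)] compact_imp_bounded by auto
  then obtain L where L: "\<And>x. x \<in> {s..t} \<Longrightarrow> norm (g' x) \<le> L" unfolding bounded_iff by blast
  have "norm (g x - g y) \<le> L * norm (x - y)" if "x \<in> {s..t}" "y \<in> {s..t}" for x y
    by (rule field_differentiable_bound[of "{s..t}" g g' L]) (use g'(2) L that in auto)
  then show ?thesis by (intro exI[of _ L] ballI) simp
qed

lemma fourier_expansion:
  assumes c: "c > 1" and \<alpha>: "\<alpha> > 0" and \<theta>: "smooth_admissable c \<alpha> \<theta>"
  shows "(\<lambda>k. norm (fourier_coeff c \<alpha> \<theta> k)) summable_on UNIV"
    and "((\<lambda>k. fourier_coeff c \<alpha> \<theta> k * exp (freq c \<alpha> k * of_real x)) has_sum of_real (\<theta> x)) UNIV"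
proof -
  define p where "p = ln (c powr (1 / \<alpha>))"
  have p_eq: "p = ln c / \<alpha>" and p: "p > 0" using c \<alpha> by (simp_all add: p_def ln_powr)
  have per: "\<theta> (x + p) = \<theta> x" for x
    using \<theta> by (simp add: smooth_admissable_def admissable_def p_def)
  have perint: "\<theta> (x + of_int m * p) = \<theta> x" for x m
    by (rule periodic_plus_of_int_mult) (rule per)
  \<comment> \<open>The length 2 p leaves room for a base point in [0, p] and a step of at most
    p.\<close>
  obtain S where S: "finite S"
    "\<And>s t. 0 \<le> s \<Longrightarrow> s < t \<Longrightarrow> t \<le> 2 * p \<Longrightarrow> {s<..<t} \<inter> S = {} \<Longrightarrow> cont_diff_on_Icc \<theta> s t"
    using \<theta> p unfolding smooth_admissable_def piecewise_cont_diff_def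
    by (metis mult_pos_pos zero_less_numeral)
  have "\<exists>L. \<forall>x\<in>{0..2*p}. \<forall>y\<in>{0..2*p}. \<bar>\<theta> x - \<theta> y\<bar> \<le> L * \<bar>x - y\<bar>"
    by (rule piecewise_lipschitz[OF S(1) _ cont_diff_on_Icc_lipschitz[OF S(2)]]) (use p in auto)
  then obtain L where L: "\<And>x y. x \<in> {0..2*p} \<Longrightarrow> y \<in> {0..2*p} \<Longrightarrow> \<bar>\<theta> x - \<theta> y\<bar> \<le> L * \<bar>x - y\<bar>" by blast
  interpret lipschitz_periodic \<theta> p L
  proof
    show "continuous_on UNIV \<theta>" using \<theta> by (simp add: smooth_admissable_def)
    show "\<bar>\<theta> (x + s) - \<theta> x\<bar> \<le> L * s" if s: "0 \<le> s" "s \<le> p" for x s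
    proof -
      define m where "m = \<lfloor>x / p\<rfloor>"
      define y where "y = x - of_int m * p"
      have y: "0 \<le> y" "y \<le> p"
        using floor_divide_lower[OF p, of x] floor_divide_upper[OF p, of x]
        by (auto simp: y_def m_def algebra_simps)
      have "\<theta> x = \<theta> y" "\<theta> (x + s) = \<theta> (y + s)"
        using perint[of y m] perint[of "y + s" m] by (auto simp: y_def algebra_simps)
      then show ?thesis using L[of "y + s" y] s y by simp
    qed
  qed (use p per in auto)
  have ct: "c_tilde c \<alpha> = 2 * pi / p" using \<alpha> by (simp add: c_tilde_def p_eq)
  have e: "exp (freq c \<alpha> k * of_real x) = per_exp p k x" for k x
    by (simp add: per_exp_def freq_def ct cis_conv_exp mult_ac)
  have e': "exp (- freq c \<alpha> k * of_real x) = cnj (per_exp p k x)" for k x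
    using e[of "- k" x] per_exp_mult_cnj[of p 0 x k] by (simp add: freq_def)
  have co: "fourier_coeff c \<alpha> \<theta> k = coeff k" for k
    unfolding fourier_coeff_def coeff_def e' p_def[symmetric] ..
  show "(\<lambda>k. norm (fourier_coeff c \<alpha> \<theta> k)) summable_on UNIV"
    unfolding co by (rule abs_summable_coeff)
  show "((\<lambda>k. fourier_coeff c \<alpha> \<theta> k * exp (freq c \<alpha> k * of_real x)) has_sum of_real (\<theta> x)) UNIV"
    unfolding co e by (rule fourier_series)
qed

section \<open>Kernels and dominated convergence\<close>

lemma set_integrable_powr_near_0:
  assumes "a > -1" shows "set_integrable lborel {0<..1} (\<lambda>y::real. y powr a)"
proof -
  have "(\<lambda>y::real. y powr a) absolutely_integrable_on {0<..1}"
    by (rule nonnegative_absolutely_integrable_1) (use integrable_on_powr_from_0'[OF assms] in auto)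
  then show ?thesis unfolding set_integrable_def by (subst (asm) integrable_completion) auto
qed

lemma set_integrable_powr_at_top:
  assumes "a < -1" shows "set_integrable lborel {1<..} (\<lambda>y::real. y powr a)"
proof -
  have "(\<lambda>y::real. y powr a) absolutely_integrable_on {1..}"
    by (rule nonnegative_absolutely_integrable_1)
       (use has_integral_powr_to_inf[OF assms, of 1] in \<open>auto simp: has_integral_integrable\<close>)
  then have "set_integrable lborel {1..} (\<lambda>y::real. y powr a)"
    unfolding set_integrable_def by (subst (asm) integrable_completion) auto
  then show ?thesis by (rule set_integrable_subset) auto
qed

text \<open>For \<alpha> < 1 the weight is integrable at 0 and at most 1 beyond 1, so boundedness of
  g serves near 0 and its integrability far away. For \<alpha> > 1 the weight is integrable at
  infinity, and the linear bound turns it into y^(1 - \<alpha>) near 0, which is integrable as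
  \<alpha> < 2.\<close>

lemma weighted_integrable:
  fixes g :: "real \<Rightarrow> complex"
  assumes g: "g \<in> borel_measurable borel" and gB: "\<And>y. norm (g y) \<le> B"
    and cases: "0 < \<alpha> \<and> \<alpha> < 1 \<and> integrable lborel g \<or> 1 < \<alpha> \<and> \<alpha> < 2 \<and> (\<forall>y>0. norm (g y) \<le> C * y)"
  shows "set_integrable lborel {0<..} (\<lambda>y. y powr - \<alpha> * norm (g y))"
proof -
  note [measurable] = g
  have m: "set_borel_measurable lborel S (\<lambda>y. y powr - \<alpha> * norm (g y))" if "S \<in> sets borel" for S
    unfolding set_borel_measurable_def using that by measurable
  have B0: "B \<ge> 0" by (rule order_trans[OF norm_ge_zero gB])
  have near: "set_integrable lborel {0<..1} (\<lambda>y. y powr - \<alpha> * norm (g y))"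
    using cases
  proof
    assume a: "0 < \<alpha> \<and> \<alpha> < 1 \<and> integrable lborel g"
    have i: "set_integrable lborel {0<..1} (\<lambda>y. B * y powr - \<alpha>)"
      using a by (intro set_integrable_mult_right set_integrable_powr_near_0) auto
    show ?thesis
      by (rule set_integrable_bound[OF i m])
         (use gB B0 in \<open>auto simp: abs_mult mult.commute intro!: AE_I2 mult_left_mono\<close>)
  next
    assume a: "1 < \<alpha> \<and> \<alpha> < 2 \<and> (\<forall>y>0. norm (g y) \<le> C * y)"
    have i: "set_integrable lborel {0<..1} (\<lambda>y. C * y powr (1 - \<alpha>))"
      using a by (intro set_integrable_mult_right set_integrable_powr_near_0) auto
    show ?thesis
    proof (rule set_integrable_bound[OF i m])
      have "norm (y powr - \<alpha> * norm (g y)) \<le> norm (C * y powr (1 - \<alpha>))" if "y > 0" for y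
      proof -
        have "norm (y powr - \<alpha> * norm (g y)) = y powr - \<alpha> * norm (g y)" by (simp add: abs_mult)
        also have "\<dots> \<le> y powr - \<alpha> * (C * y)" using a that by (intro mult_left_mono) auto
        also have "\<dots> = C * y powr (1 - \<alpha>)" using that by (simp add: powr_diff powr_minus field_simps)
        finally show ?thesis by simp
      qed
      then show "AE x in lborel. x \<in> {0<..1} \<longrightarrow> norm (x powr - \<alpha> * norm (g x)) \<le> norm (C * x powr (1 - \<alpha>))"
        by auto
    qed auto
  qed
  have far: "set_integrable lborel {1<..} (\<lambda>y. y powr - \<alpha> * norm (g y))"
    using cases
  proof
    assume a: "0 < \<alpha> \<and> \<alpha> < 1 \<and> integrable lborel g"
    have i: "set_integrable lborel {1<..} g"
      unfolding set_integrable_def using a by (intro integrable_mult_indicator) auto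
    show ?thesis
    proof (rule set_integrable_bound[OF i m])
      have "y powr - \<alpha> \<le> 1" if "y > 1" for y
        using powr_mono[of "- \<alpha>" 0 y] a that by auto
      then show "AE y in lborel. y \<in> {1<..} \<longrightarrow> norm (y powr - \<alpha> * norm (g y)) \<le> norm (g y)"
        by (auto simp: abs_mult intro!: AE_I2 mult_left_le_one_le)
    qed auto
  next
    assume a: "1 < \<alpha> \<and> \<alpha> < 2 \<and> (\<forall>y>0. norm (g y) \<le> C * y)"
    have i: "set_integrable lborel {1<..} (\<lambda>y. B * y powr - \<alpha>)"
      using a by (intro set_integrable_mult_right set_integrable_powr_at_top) auto
    show ?thesis
      by (rule set_integrable_bound[OF i m])
         (use gB B0 in \<open>auto simp: abs_mult mult.commute intro!: AE_I2 mult_left_mono\<close>)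
  qed
  have "{0<..} = {0<..1} \<union> {1::real<..}" by auto
  then show ?thesis using set_integrable_Un[OF near far] by simp
qed

text \<open>Fubini on 0 < s < y: integrating over y first leaves the mass of \<open>{s<..}\<close>,
  which is the prescribed tail. The measure is accessed through its tails alone, never through a
  density.\<close>

lemma levy_measure_primitive_integral:
  fixes g :: "real \<Rightarrow> complex"
  assumes \<phi>: "is_levy_measure \<alpha> \<theta> \<phi>" and \<theta>: "\<theta> \<in> borel_measurable borel" "\<And>y. 0 < \<theta> y" "\<And>y. \<theta> y \<le> T"
    and g: "g \<in> borel_measurable borel"
    and int: "set_integrable lborel {0<..} (\<lambda>y. y powr - \<alpha> * norm (g y))"
  shows "integrable \<phi> (\<lambda>y. LINT s:{0<..<y}|lborel. g s)"
    and "(LINT y|\<phi>. (LINT s:{0<..<y}|lborel. g s))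
        = (LINT s:{0<..}|lborel. of_real (s powr - \<alpha> * \<theta> (ln s)) * g s)"
proof -
  have sets: "sets \<phi> = sets (restrict_space borel {0<..})"
    and em: "\<And>r. r > 0 \<Longrightarrow> emeasure \<phi> {r<..} = ennreal (r powr - \<alpha> * \<theta> (ln r))"
    using \<phi> by (auto simp: is_levy_measure_def)
  have space: "space \<phi> = {0<..}"
    using sets_eq_imp_space_eq[OF sets] by (simp add: space_restrict_space)
  have tail: "{r<..} \<in> sets \<phi>" if "r > 0" for r
    unfolding sets using that by (subst sets_restrict_space_iff) auto
  have pos: "r powr - \<alpha> * \<theta> (ln r) \<ge> 0" for r using \<theta>(2)[of "ln r"] by simp
  \<comment> \<open>The total mass near 0 may be infinite, so the exhausting sets stay away from 0;
    each has finite mass by the tail formula.\<close>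
  interpret \<phi>: sigma_finite_measure \<phi>
  proof
    let ?A = "range (\<lambda>n. {1 / real (Suc n)<..})"
    have "\<Union>?A = {0<..}"
    proof (intro equalityI subsetI)
      fix x :: real assume "x \<in> {0<..}"
      then obtain n where "inverse (real (Suc n)) < x" using reals_Archimedean by auto
      then show "x \<in> \<Union>?A" by (auto simp: inverse_eq_divide)
    next
      fix x assume "x \<in> \<Union>?A"
      then obtain n where "1 / real (Suc n) < x" by auto
      moreover have "0 < 1 / real (Suc n)" by simp
      ultimately have "0 < x" by (rule less_trans[rotated])
      then show "x \<in> {0<..}" by simp
    qed
    then show "\<exists>A. countable A \<and> A \<subseteq> sets \<phi> \<and> \<Union>A = space \<phi> \<and> (\<forall>a\<in>A. emeasure \<phi> a \<noteq> \<infinity>)"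
      using tail em by (intro exI[of _ ?A]) (auto simp: space)
  qed
  interpret P: pair_sigma_finite lborel \<phi> ..
  have id_meas: "(\<lambda>y. y) \<in> borel_measurable \<phi>"
    by (subst measurable_cong_sets[OF sets refl]) (simp add: measurable_restrict_space1)
  have [measurable]: "fst \<in> borel_measurable (lborel \<Otimes>\<^sub>M \<phi>)"
    using measurable_fst[of lborel \<phi>] by simp
  have [measurable]: "snd \<in> borel_measurable (lborel \<Otimes>\<^sub>M \<phi>)"
    using measurable_compose[OF measurable_snd id_meas, of lborel] by simp
  note [measurable] = g \<theta>(1)
  define F where "F = (\<lambda>s y. indicat_real {0<..<y} s *\<^sub>R g s)"
  have F_meas: "case_prod F \<in> borel_measurable (lborel \<Otimes>\<^sub>M \<phi>)"
  proof -
    have "case_prod F = (\<lambda>p. if 0 < fst p \<and> fst p < snd p then g (fst p) else 0)"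
      by (auto simp: F_def indicator_def fun_eq_iff)
    moreover have "\<dots> \<in> borel_measurable (lborel \<Otimes>\<^sub>M \<phi>)" by measurable
    ultimately show ?thesis by simp
  qed
  have F_alt: "F s y = indicat_real {s<..} y *\<^sub>R (indicat_real {0<..} s *\<^sub>R g s)" for s y
    by (auto simp: F_def indicator_def)
  have F0: "F s = (\<lambda>_. 0)" if "s \<le> 0" for s using that by (simp add: F_def fun_eq_iff)
  have cap: "{s<..} \<inter> {0<..} = {s<..}" if "s > 0" for s :: real using that by auto
  have meas: "measure \<phi> {s<..} = s powr - \<alpha> * \<theta> (ln s)" if "s > 0" for s
    using em[OF that] pos[of s] by (simp add: measure_def)
  have Fint: "integrable \<phi> (F s)" for s
  proof (cases "s > 0")
    case True
    then show ?thesis unfolding F_alt[abs_def] using tail[OF True] em[OF True]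
      by (intro integrable_scaleR_left) (simp add: space cap[OF True] integrable_indicator_iff)
  qed (simp add: F0)
  have Fval: "(LINT y|\<phi>. F s y) = indicat_real {0<..} s *\<^sub>R (of_real (s powr - \<alpha> * \<theta> (ln s)) * g s)" for s
  proof (cases "s > 0")
    case True
    have "(LINT y|\<phi>. F s y) = measure \<phi> {s<..} *\<^sub>R (indicat_real {0<..} s *\<^sub>R g s)"
      unfolding F_alt using tail[OF True] em[OF True]
      by (subst integral_scaleR_left) (auto simp: space cap[OF True] integrable_indicator_iff)
    then show ?thesis using True by (simp add: meas scaleR_conv_of_real)
  qed (simp add: F0)
  have Fnorm: "(LINT y|\<phi>. norm (F s y)) = indicat_real {0<..} s *\<^sub>R (s powr - \<alpha> * \<theta> (ln s) * norm (g s))" for s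
  proof (cases "s > 0")
    case True
    have "(LINT y|\<phi>. norm (F s y)) = (LINT y|\<phi>. indicat_real {s<..} y *\<^sub>R norm (g s))"
      using True by (intro Bochner_Integration.integral_cong) (auto simp: F_alt)
    also have "\<dots> = measure \<phi> {s<..} *\<^sub>R norm (g s)"
      using tail[OF True] em[OF True]
      by (subst integral_scaleR_left) (auto simp: space cap[OF True] integrable_indicator_iff)
    finally show ?thesis using True by (simp add: meas)
  qed (simp add: F0)
  \<comment> \<open>The bound T carries the assumed integrability of
    \<open>y powr - \<alpha> * norm (g y)\<close> over to the integrand with the extra factor
    \<open>\<theta> (ln y)\<close>, as the Fubini condition demands.\<close>
  have T0: "T \<ge> 0" using \<theta>(2,3)[of 0] by linarith
  have int': "integrable lborel (\<lambda>s. T * (indicat_real {0<..} s *\<^sub>R (s powr - \<alpha> * norm (g s))))"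
    using int unfolding set_integrable_def by (rule integrable_mult_right)
  have "integrable lborel (\<lambda>s. LINT y|\<phi>. norm (F s y))"
    unfolding Fnorm
  proof (rule Bochner_Integration.integrable_bound[OF int'])
    have "indicat_real {0<..} s *\<^sub>R (s powr - \<alpha> * \<theta> (ln s) * norm (g s))
        \<le> T * (indicat_real {0<..} s *\<^sub>R (s powr - \<alpha> * norm (g s)))" for s
    proof -
      have "\<theta> (ln s) * (indicat_real {0<..} s * (s powr - \<alpha> * norm (g s)))
          \<le> T * (indicat_real {0<..} s * (s powr - \<alpha> * norm (g s)))"
        by (intro mult_right_mono \<theta>) auto
      then show ?thesis by (simp add: mult_ac)
    qed
    moreover have "0 \<le> indicat_real {0<..} s *\<^sub>R (s powr - \<alpha> * \<theta> (ln s) * norm (g s))" for s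
      using pos[of s] by simp
    ultimately have "norm (indicat_real {0<..} s *\<^sub>R (s powr - \<alpha> * \<theta> (ln s) * norm (g s)))
        \<le> norm (T * (indicat_real {0<..} s *\<^sub>R (s powr - \<alpha> * norm (g s))))" for s
      unfolding real_norm_def by (smt (verit))
    then show "AE s in lborel. norm (indicat_real {0<..} s *\<^sub>R (s powr - \<alpha> * \<theta> (ln s) * norm (g s)))
        \<le> norm (T * (indicat_real {0<..} s *\<^sub>R (s powr - \<alpha> * norm (g s))))" by simp
  qed measurable
  then have FI: "integrable (lborel \<Otimes>\<^sub>M \<phi>) (case_prod F)"
    by (intro P.Fubini_integrable F_meas) (auto simp: Fint)
  show "integrable \<phi> (\<lambda>y. LINT s:{0<..<y}|lborel. g s)"
    using P.integrable_snd[OF FI] by (simp add: F_def set_lebesgue_integral_def)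
  show "(LINT y|\<phi>. (LINT s:{0<..<y}|lborel. g s))
        = (LINT s:{0<..}|lborel. of_real (s powr - \<alpha> * \<theta> (ln s)) * g s)"
    using P.Fubini_integral[OF FI] unfolding Fval by (simp add: F_def set_lebesgue_integral_def)
qed

text \<open>Rounding up, rather than down, keeps the step function constant on each \<open>{j * h<..(j + 1) * h}\<close>
  and makes the bound below valid on all of \<open>{0<..}\<close>.\<close>

definition gl_kernel :: "complex \<Rightarrow> real \<Rightarrow> real \<Rightarrow> complex" where
  "gl_kernel \<beta> h y = of_real h powr - \<beta> * gl_coeff \<beta> (nat (\<lceil>y / h\<rceil> - 1))"

lemma gl_kernel_measurable [measurable]: "gl_kernel \<beta> h \<in> borel_measurable borel"
  unfolding gl_kernel_def by measurable

lemma ceiling_step: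
  assumes "h > 0" "y > 0"
  shows "h * real (nat (\<lceil>y / h\<rceil> - 1)) < y" "y \<le> h * (real (nat (\<lceil>y / h\<rceil> - 1)) + 1)"
proof -
  have "y / h > 0" using assms by simp
  then have "\<lceil>y / h\<rceil> \<ge> 1" by linarith
  then have e: "real (nat (\<lceil>y / h\<rceil> - 1)) = of_int \<lceil>y / h\<rceil> - 1" by simp
  have "of_int \<lceil>y / h\<rceil> - 1 < y / h" "y / h \<le> of_int \<lceil>y / h\<rceil>" by linarith+
  from this(1)[unfolded pos_less_divide_eq[OF assms(1)]] this(2)[unfolded pos_divide_le_eq[OF assms(1)]]
  show "h * real (nat (\<lceil>y / h\<rceil> - 1)) < y" "y \<le> h * (real (nat (\<lceil>y / h\<rceil> - 1)) + 1)"
    unfolding e by (simp_all add: mult.commute)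
qed

lemma gl_kernel_step:
  assumes "h > 0" "real j * h < y" "y \<le> real (Suc j) * h"
  shows "gl_kernel \<beta> h y = of_real h powr - \<beta> * gl_coeff \<beta> j"
proof -
  have "\<lceil>y / h\<rceil> = int j + 1"
    using assms by (intro ceiling_unique) (auto simp: field_simps)
  then show ?thesis by (simp add: gl_kernel_def)
qed

text \<open>Rounding up gives y \<le> h (j + 1), and negative powers decrease; this matches the base
  j + 1 in the coefficient bound, so no constant is lost.\<close>

lemma gl_kernel_bound:
  assumes "0 < \<alpha>" and C: "\<And>j. norm (gl_coeff \<beta> j) \<le> C * (real j + 1) powr - \<alpha>" and "C \<ge> 0"
    and "Re \<beta> = \<alpha>" "h > 0" "y > 0"
  shows "norm (gl_kernel \<beta> h y) \<le> C * y powr - \<alpha>"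
proof -
  define j where "j = nat (\<lceil>y / h\<rceil> - 1)"
  have "norm (complex_of_real h powr - \<beta>) = h powr - \<alpha>"
    using norm_powr_real_powr[of h "- \<beta>"] assms by simp
  then have "norm (gl_kernel \<beta> h y) = h powr - \<alpha> * norm (gl_coeff \<beta> j)"
    by (simp add: gl_kernel_def j_def norm_mult)
  also have "\<dots> \<le> h powr - \<alpha> * (C * (real j + 1) powr - \<alpha>)" by (intro mult_left_mono C) auto
  also have "\<dots> = C * (h * (real j + 1)) powr - \<alpha>" using assms by (simp add: powr_mult mult_ac)
  also have "\<dots> \<le> C * y powr - \<alpha>"
    using ceiling_step(2)[of h y] assms by (intro mult_left_mono powr_mono2') (auto simp: j_def)
  finally show ?thesis .
qed

text \<open>With j one less than y / h rounded up, the kernel is (h j)^(-\<beta>) times a_j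
  j^\<beta>. As h falls to 0, h j tends to y and j to infinity, so the second factor tends to
  1.\<close>

lemma gl_kernel_tendsto:
  assumes \<beta>: "1 - \<beta> \<notin> \<int>\<^sub>\<le>\<^sub>0" and y: "y > 0"
  shows "((\<lambda>h. gl_kernel \<beta> h y) \<longlongrightarrow> of_real y powr - \<beta>) (at_right 0)"
proof -
  define j where "j h = nat (\<lceil>y / h\<rceil> - 1)" for h
  have ev: "eventually (\<lambda>h::real. h > 0 \<and> h < y) (at_right 0)"
    using y by (auto simp: eventually_at_right[OF y])
  have st: "h * real (j h) < y" "y \<le> h * (real (j h) + 1)" if "h > 0" for h
    using ceiling_step[OF that y] by (auto simp: j_def)
  have hj: "((\<lambda>h. h * real (j h)) \<longlongrightarrow> y) (at_right 0)"
  proof (rule tendsto_sandwich)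
    show "eventually (\<lambda>h. y - h \<le> h * real (j h)) (at_right 0)"
      using ev by eventually_elim (use st in \<open>auto simp: algebra_simps\<close>)
    show "eventually (\<lambda>h. h * real (j h) \<le> y) (at_right 0)"
      using ev by eventually_elim (use st in \<open>auto intro: less_imp_le\<close>)
    show "((\<lambda>h. y - h) \<longlongrightarrow> y) (at_right 0)" by (rule tendsto_eq_intros refl | simp)+
  qed auto
  have "filterlim (\<lambda>h. y * inverse h - 1) at_top (at_right 0)"
    unfolding diff_conv_add_uminus
    by (intro filterlim_tendsto_add_at_top[OF tendsto_const] filterlim_tendsto_pos_mult_at_top[OF tendsto_const y]
        filterlim_inverse_at_top_right | subst add.commute)+
  then have "filterlim (\<lambda>h. real (j h)) at_top (at_right 0)"
  proof (rule filterlim_at_top_mono)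
    show "eventually (\<lambda>h. y * inverse h - 1 \<le> real (j h)) (at_right 0)"
      using ev by eventually_elim (use st in \<open>auto simp: field_simps\<close>)
  qed
  then have jtop: "filterlim j sequentially (at_right 0)"
    by (simp add: filterlim_sequentially_iff_filterlim_real)
  have "((\<lambda>h. of_real (h * real (j h)) powr - \<beta> * (gl_coeff \<beta> (j h) * of_nat (j h) powr \<beta>))
      \<longlongrightarrow> of_real y powr - \<beta> * 1) (at_right 0)"
  proof (intro tendsto_mult filterlim_compose[OF gl_coeff_asymp[OF \<beta>] jtop])
    show "((\<lambda>h. complex_of_real (h * real (j h)) powr - \<beta>) \<longlongrightarrow> of_real y powr - \<beta>) (at_right 0)"
      using y by (intro tendsto_powr_complex tendsto_of_real hj tendsto_const) (auto simp: complex_nonpos_Reals_iff)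
  qed
  then have "((\<lambda>h. of_real (h * real (j h)) powr - \<beta> * (gl_coeff \<beta> (j h) * of_nat (j h) powr \<beta>))
      \<longlongrightarrow> of_real y powr - \<beta>) (at_right 0)" by simp
  moreover have "eventually (\<lambda>h. of_real (h * real (j h)) powr - \<beta> * (gl_coeff \<beta> (j h) * of_nat (j h) powr \<beta>)
      = gl_kernel \<beta> h y) (at_right 0)"
    using ev
  proof eventually_elim
    case (elim h)
    \<comment> \<open>h < y excludes j = 0, where \<open>0 powr\<close> would be 0 and the splitting
      of powers would fail.\<close>
    have "h < h * (real (j h) + 1)" using st(2)[of h] elim by linarith
    then have j0: "real (j h) > 0" using elim by (simp add: algebra_simps zero_less_mult_iff)
    have "complex_of_real (h * real (j h)) powr - \<beta> = of_real h powr - \<beta> * of_nat (j h) powr - \<beta>"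
      using powr_times_real_left[of "complex_of_real h" "of_nat (j h)" "- \<beta>"] elim by simp
    moreover have "(of_nat (j h) :: complex) powr - \<beta> * of_nat (j h) powr \<beta> = 1"
      using j0 by (simp add: powr_minus)
    ultimately show ?case by (simp add: gl_kernel_def j_def mult_ac)
  qed
  ultimately show ?thesis by (rule Lim_transform_eventually)
qed

text \<open>Tannery's theorem along an arbitrary filter. The limits inherit the majorant M, so each
  of the two infinite sums differs from its finite part over K by less than e / 3, for all h
  satisfying the bound.\<close>

lemma tendsto_infsum_dominated:
  fixes F :: "'k \<Rightarrow> 'a \<Rightarrow> 'b::banach"
  assumes lim: "\<And>k. (F k \<longlongrightarrow> G k) \<F>" and M: "M summable_on UNIV"
    and bound: "eventually (\<lambda>h. \<forall>k. norm (F k h) \<le> M k) \<F>" and nt: "\<F> \<noteq> bot"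
  shows "((\<lambda>h. \<Sum>\<^sub>\<infinity>k. F k h) \<longlongrightarrow> (\<Sum>\<^sub>\<infinity>k. G k)) \<F>"
proof -
  have Gb: "norm (G k) \<le> M k" for k
    by (rule tendsto_upperbound[OF tendsto_norm[OF lim] _ nt]) (use bound in eventually_elim, auto)
  have M0: "M k \<ge> 0" for k using Gb[of k] order_trans[OF norm_ge_zero] by blast
  have tail: "norm (infsum f UNIV - sum f K) \<le> infsum M UNIV - sum M K"
    if f: "\<And>k. norm (f k) \<le> M k" and K: "finite K" for f :: "'k \<Rightarrow> 'b" and K
  proof -
    have fs: "f summable_on UNIV"
      by (rule Infinite_Sum.abs_summable_summable, rule Infinite_Sum.abs_summable_on_comparison_test[of M]) (use M f M0 in auto)
    have "(f has_sum (infsum f UNIV - sum f K)) (UNIV - K)"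
      by (rule has_sum_Diff) (use fs K in \<open>auto intro: has_sum_finite\<close>)
    moreover have "(M has_sum (infsum M UNIV - sum M K)) (UNIV - K)"
      by (rule has_sum_Diff) (use M K in \<open>auto intro: has_sum_finite\<close>)
    ultimately show ?thesis by (rule norm_infsum_le) (rule f)
  qed
  show ?thesis
  proof (rule tendstoI)
    fix e :: real assume e: "e > 0"
    obtain K where K: "finite K" "infsum M UNIV - sum M K < e / 3"
    proof -
      have "(sum M \<longlongrightarrow> infsum M UNIV) (finite_subsets_at_top UNIV)"
        using M by (rule infsum_tendsto)
      from tendstoD[OF this, of "e / 3"] e
      have "eventually (\<lambda>K. dist (sum M K) (infsum M UNIV) < e / 3) (finite_subsets_at_top UNIV)" by simp
      then obtain K where "finite K" "dist (sum M K) (infsum M UNIV) < e / 3"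
        unfolding eventually_finite_subsets_at_top by auto
      moreover from this have "infsum M UNIV - sum M K < e / 3" unfolding dist_real_def by linarith
      ultimately show ?thesis using that by blast
    qed
    have "((\<lambda>h. \<Sum>k\<in>K. F k h) \<longlongrightarrow> (\<Sum>k\<in>K. G k)) \<F>" by (intro tendsto_sum lim)
    from tendstoD[OF this, of "e / 3"] e
    have "eventually (\<lambda>h. dist (\<Sum>k\<in>K. F k h) (\<Sum>k\<in>K. G k) < e / 3) \<F>" by simp
    then show "eventually (\<lambda>h. dist (\<Sum>\<^sub>\<infinity>k. F k h) (\<Sum>\<^sub>\<infinity>k. G k) < e) \<F>"
      using bound
    proof eventually_elim
      case (elim h)
      have "dist (\<Sum>\<^sub>\<infinity>k. F k h) (\<Sum>k\<in>K. F k h) < e / 3"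
        using tail[of "\<lambda>k. F k h" K] elim(2) K by (auto simp: dist_norm)
      moreover have "dist (\<Sum>\<^sub>\<infinity>k. G k) (\<Sum>k\<in>K. G k) < e / 3"
        using tail[of G K] Gb K by (auto simp: dist_norm)
      ultimately show ?case using elim(1)
        dist_triangle[of "\<Sum>\<^sub>\<infinity>k. F k h" "\<Sum>\<^sub>\<infinity>k. G k" "\<Sum>k\<in>K. F k h"]
        dist_triangle2[of "\<Sum>k\<in>K. F k h" "\<Sum>\<^sub>\<infinity>k. G k" "\<Sum>k\<in>K. G k"]
        by linarith
    qed
  qed
qed

section \<open>The difference and the derivative at a point\<close>

lemma Re_freq [simp]: "Re (freq c \<alpha> k) = 0"
  by (simp add: freq_def)

text \<open>Collects what is used of f at a single point x. Higher derivatives no longer appear;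
  continuity of f' and the weighted integrability \<open>int\<close> stand in for them.\<close>

locale gl_point =
  fixes \<alpha> :: real and f f' :: "real \<Rightarrow> complex" and x :: real
  assumes \<alpha>: "0 < \<alpha>" "\<alpha> < 2" "\<alpha> \<noteq> 1"
    and deriv: "\<And>y. (f has_vector_derivative f' y) (at y)"
    and cont: "continuous_on UNIV f'"
    and bounded: "bounded (range f)"
    and int: "set_integrable lborel {0<..} (\<lambda>y. y powr - \<alpha> * norm (f' (x - y) - (if \<alpha> < 1 then 0 else f' x)))"
begin

definition D :: complex where "D = (if \<alpha> < 1 then 0 else f' x)"

definition g :: "real \<Rightarrow> complex" where "g y = f' (x - y) - D"

definition W :: real where "W = (LINT y:{0<..}|lborel. y powr - \<alpha> * norm (g y))"

lemma int_g: "set_integrable lborel {0<..} (\<lambda>y. y powr - \<alpha> * norm (g y))"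
  using int by (simp add: g_def D_def)

lemma cont_g: "continuous_on S g"
  unfolding g_def by (intro continuous_intros continuous_on_compose2[OF cont]) auto

lemma meas_g [measurable]: "g \<in> borel_measurable borel"
  by (intro borel_measurable_continuous_onI cont_g)

lemma notin_nonpos_Ints: "Re \<beta> = \<alpha> \<Longrightarrow> 1 - \<beta> \<notin> \<int>\<^sub>\<le>\<^sub>0"
  by (rule one_minus_notin_nonpos_Ints) (use \<alpha> in auto)

text \<open>All kernels below are O(y^(-\<alpha>)) with constants independent of the mode and of h,
  so the single number W bounds every integral against g.\<close>

lemma dominated:
  fixes F :: "real \<Rightarrow> complex"
  assumes F: "F \<in> borel_measurable borel" and C: "\<And>y. y > 0 \<Longrightarrow> norm (F y) \<le> C * y powr - \<alpha>"
  shows "set_integrable lborel {0<..} (\<lambda>y. F y * g y)"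
    and "norm (LINT y:{0<..}|lborel. F y * g y) \<le> C * W"
proof -
  note [measurable] = F
  have i: "set_integrable lborel {0<..} (\<lambda>y. C * (y powr - \<alpha> * norm (g y)))"
    by (intro set_integrable_mult_right int_g)
  have b: "norm (F y * g y) \<le> C * (y powr - \<alpha> * norm (g y))" if "y > 0" for y
    using mult_right_mono[OF C[OF that], of "norm (g y)"] by (simp add: norm_mult mult.assoc)
  show s: "set_integrable lborel {0<..} (\<lambda>y. F y * g y)"
  proof (rule set_integrable_bound[OF i])
    show "set_borel_measurable lborel {0<..} (\<lambda>y. F y * g y)"
      unfolding set_borel_measurable_def by measurable
    show "AE y in lborel. y \<in> {0<..} \<longrightarrow> norm (F y * g y) \<le> norm (C * (y powr - \<alpha> * norm (g y)))"
    proof (intro AE_I2 impI)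
      fix y :: real assume "y \<in> {0<..}"
      then show "norm (F y * g y) \<le> norm (C * (y powr - \<alpha> * norm (g y)))"
        using b[of y] unfolding real_norm_def by (simp add: order_trans[OF _ abs_ge_self])
    qed
  qed
  have "norm (LINT y:{0<..}|lborel. F y * g y) \<le> (LINT y|lborel. norm (indicat_real {0<..} y *\<^sub>R (F y * g y)))"
    unfolding set_lebesgue_integral_def by (rule integral_norm_bound)
  also have "\<dots> = (LINT y:{0<..}|lborel. norm (F y * g y))"
    unfolding set_lebesgue_integral_def by simp
  also have "\<dots> \<le> (LINT y:{0<..}|lborel. C * (y powr - \<alpha> * norm (g y)))"
    using b set_integrable_norm[OF s] i by (intro set_integral_mono) auto
  also have "\<dots> = C * W" unfolding W_def by (rule set_integral_mult_right)
  finally show "norm (LINT y:{0<..}|lborel. F y * g y) \<le> C * W" .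
qed

text \<open>- f (x - s) - s D is a primitive of g in s. S is only squeezed between the open and the
  closed interval, because the semi-fractional integrand needs \<open>{0<..<y}\<close> whereas the
  cells of the kernel are half-open.\<close>

lemma primitive:
  assumes ab: "0 \<le> a" "a \<le> b" and S: "{a<..<b} \<subseteq> S" "S \<subseteq> {a..b}" "S \<in> sets borel"
  shows "(LINT s:S|lborel. g s) = f (x - a) - f (x - b) - of_real (b - a) * D"
proof -
  have "set_integrable lborel {a..b} g" by (intro borel_integrable_atLeastAtMost' cont_g)
  then have "set_integrable lborel S g" by (rule set_integrable_subset) (use S in auto)
  then have "(LINT s:S|lborel. g s) = integral S g" by (rule set_borel_integral_eq_integral)
  also have "\<dots> = integral {a..b} g"
  proof (rule integral_spike_set)
    have sub: "{a..b} - S \<subseteq> {a, b}"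
    proof
      fix s assume s: "s \<in> {a..b} - S"
      then have "s \<notin> {a<..<b}" using S(1) by blast
      then show "s \<in> {a, b}" using s by auto
    qed
    show "negligible {y \<in> {a..b} - S. g y \<noteq> 0}"
      by (rule negligible_subset[of "{a, b}"]) (use sub in auto)
    have "{y \<in> S - {a..b}. g y \<noteq> 0} = {}" using S(2) by auto
    then show "negligible {y \<in> S - {a..b}. g y \<noteq> 0}" by (simp only: negligible_empty)
  qed
  also have "\<dots> = (- f (x - b) - of_real b * D) - (- f (x - a) - of_real a * D)"
  proof (rule integral_unique, rule fundamental_theorem_of_calculus[OF ab(2)])
    fix s
    have "((\<lambda>s. x - s) has_vector_derivative - 1) (at s within {a..b})"
      by (auto intro!: derivative_eq_intros)
    from vector_diff_chain_within[OF this has_vector_derivative_at_within[OF deriv]]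
    have 1: "((\<lambda>s. f (x - s)) has_vector_derivative - f' (x - s)) (at s within {a..b})"
      by (simp add: o_def)
    have 2: "((\<lambda>s. of_real s * D) has_vector_derivative D) (at s within {a..b})"
      by (auto intro!: derivative_eq_intros)
    have "((\<lambda>s. - f (x - s) - of_real s * D) has_vector_derivative - (- f' (x - s)) - D) (at s within {a..b})"
      by (intro has_vector_derivative_diff has_vector_derivative_minus 1 2)
    then show "((\<lambda>s. - f (x - s) - of_real s * D) has_vector_derivative g s) (at s within {a..b})"
      by (simp add: g_def)
  qed
  finally show ?thesis by (simp add: algebra_simps)
qed

text \<open>D equals f' x precisely in the case \<alpha> > 1, where its integral y D is the
  compensating term of the integrand up to the overall sign.\<close>

lemma semifrac_integrand_eq:
  assumes "y > 0"
  shows "semifrac_integrand \<alpha> f x y = (if \<alpha> < 1 then 1 else - 1) * (LINT s:{0<..<y}|lborel. g s)"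
proof -
  have "(LINT s:{0<..<y}|lborel. g s) = f (x - 0) - f (x - y) - of_real (y - 0) * D"
    by (rule primitive) (use assms in auto)
  then show ?thesis
    using vector_derivative_at[OF deriv, of x] by (simp add: semifrac_integrand_def D_def)
qed

text \<open>The N-th partial sum splits into a boundary term, an integral over a bounded interval,
  and D times a sum of coefficients. Each part has a limit, so convergence of the series is a result
  and not an input.\<close>

lemma GL_sums:
  assumes \<beta>: "Re \<beta> = \<alpha>" and h: "h > 0"
  shows "(\<lambda>j. Gamma (1 - \<beta>) * of_real h powr - \<beta> * ((\<beta> gchoose j) * (- 1) ^ j * f (x - real j * h)))
    sums (LINT y:{0<..}|lborel. gl_kernel \<beta> h y * g y)"
proof -
  define hp where "hp = complex_of_real h powr - \<beta>"
  define u where "u j = f (x - real j * h)" for j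
  note np = notin_nonpos_Ints[OF \<beta>]
  let ?K = "\<lambda>y. gl_kernel \<beta> h y * g y"
  obtain C where C: "C > 0" "\<And>\<beta> j. Re \<beta> = \<alpha> \<Longrightarrow> norm (gl_coeff \<beta> j) \<le> C * (real j + 1) powr - \<alpha>"
    using gl_coeff_bound[OF \<alpha>] by blast
  have K_int: "set_integrable lborel {0<..} ?K"
    by (rule dominated[OF gl_kernel_measurable gl_kernel_bound[OF \<alpha>(1) C(2)[OF \<beta>] _ \<beta> h]]) (use C in auto)
  have K_sub: "set_integrable lborel {a<..b} ?K" if "0 \<le> a" for a b
    by (rule set_integrable_subset[OF K_int]) (use that in auto)
  \<comment> \<open>The increment of f over one cell is the integral of g plus h D, and the kernel
    is constant on the cell.\<close>
  have step: "hp * gl_coeff \<beta> j * (u j - u (Suc j))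
      = (LINT y:{real j * h<..real (Suc j) * h}|lborel. ?K y) + hp * of_real h * D * gl_coeff \<beta> j" for j
  proof -
    have "(LINT y:{real j * h<..real (Suc j) * h}|lborel. ?K y)
        = (LINT y:{real j * h<..real (Suc j) * h}|lborel. hp * gl_coeff \<beta> j * g y)"
      using gl_kernel_step[OF h] by (intro set_lebesgue_integral_cong) (auto simp: hp_def)
    also have "\<dots> = hp * gl_coeff \<beta> j * (LINT y:{real j * h<..real (Suc j) * h}|lborel. g y)"
      by (rule set_integral_mult_right)
    also have "(LINT y:{real j * h<..real (Suc j) * h}|lborel. g y)
        = u j - u (Suc j) - of_real (real (Suc j) * h - real j * h) * D"
      unfolding u_def by (rule primitive) (use h in auto)
    also have "real (Suc j) * h - real j * h = h" by (simp add: algebra_simps)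
    finally show ?thesis by (simp add: algebra_simps)
  qed
  have Kcollect: "(\<Sum>j\<le>N. LINT y:{real j * h<..real (Suc j) * h}|lborel. ?K y)
      = (LINT y:{0<..real (Suc N) * h}|lborel. ?K y)" for N
  proof (induction N)
    case (Suc N)
    have "{0<..real (Suc (Suc N)) * h} = {0<..real (Suc N) * h} \<union> {real (Suc N) * h<..real (Suc (Suc N)) * h}"
      using h by (intro ivl_disj_un_two(6)[symmetric]) auto
    moreover have "(LINT y:{0<..real (Suc N) * h} \<union> {real (Suc N) * h<..real (Suc (Suc N)) * h}|lborel. ?K y)
        = (LINT y:{0<..real (Suc N) * h}|lborel. ?K y) + (LINT y:{real (Suc N) * h<..real (Suc (Suc N)) * h}|lborel. ?K y)"
      by (rule set_integral_Un) (use h in \<open>auto intro!: K_sub\<close>)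
    ultimately show ?case using Suc by simp
  qed simp
  have partial: "(\<Sum>j\<le>N. Gamma (1 - \<beta>) * hp * ((\<beta> gchoose j) * (- 1) ^ j * u j))
      = hp * (gl_coeff \<beta> N * u (Suc N)) + (LINT y:{0<..real (Suc N) * h}|lborel. ?K y)
        + hp * of_real h * (D * (\<Sum>j\<le>N. gl_coeff \<beta> j))" for N
  proof -
    have "(\<Sum>j\<le>N. Gamma (1 - \<beta>) * hp * ((\<beta> gchoose j) * (- 1) ^ j * u j))
        = hp * (\<Sum>j\<le>N. (Gamma (1 - \<beta>) * ((\<beta> gchoose j) * (- 1) ^ j)) * u j)"
      by (simp add: sum_distrib_left mult_ac)
    also have "\<dots> = hp * (gl_coeff \<beta> N * u (Suc N)) + (\<Sum>j\<le>N. hp * gl_coeff \<beta> j * (u j - u (Suc j)))"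
    proof -
      have "(\<Sum>j\<le>N. (Gamma (1 - \<beta>) * ((\<beta> gchoose j) * (- 1) ^ j)) * u j)
          = gl_coeff \<beta> N * u (Suc N) + (\<Sum>j\<le>N. gl_coeff \<beta> j * (u j - u (Suc j)))"
        using sum_by_parts[of "\<lambda>j. Gamma (1 - \<beta>) * ((\<beta> gchoose j) * (- 1) ^ j)" u N]
        by (simp only: sum_gbinomial_eq_gl_coeff[OF np])
      then show ?thesis by (simp only: distrib_left sum_distrib_left mult.assoc)
    qed
    also have "\<dots> = hp * (gl_coeff \<beta> N * u (Suc N)) + (LINT y:{0<..real (Suc N) * h}|lborel. ?K y)
        + hp * of_real h * (D * (\<Sum>j\<le>N. gl_coeff \<beta> j))"
      unfolding step sum.distrib Kcollect by (simp add: sum_distrib_left mult_ac)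
    finally show ?thesis .
  qed
  have lim1: "(\<lambda>N. hp * (gl_coeff \<beta> N * u (Suc N))) \<longlonglongrightarrow> 0"
  proof -
    obtain B where B: "\<And>y. norm (f y) \<le> B" using bounded by (auto simp: bounded_iff)
    have "(\<lambda>N. norm (gl_coeff \<beta> N) * B) \<longlonglongrightarrow> 0"
      by (intro tendsto_mult_left_zero tendsto_norm_zero gl_coeff_tendsto_0 np) (use \<beta> \<alpha> in simp)
    then have "(\<lambda>N. gl_coeff \<beta> N * u (Suc N)) \<longlonglongrightarrow> 0"
      by (rule Lim_null_comparison[rotated])
         (auto simp: norm_mult u_def intro!: always_eventually mult_left_mono B)
    then show ?thesis by (rule tendsto_mult_right_zero)
  qed
  have lim2: "(\<lambda>N. LINT y:{0<..real (Suc N) * h}|lborel. ?K y) \<longlonglongrightarrow> (LINT y:{0<..}|lborel. ?K y)"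
  proof -
    have U: "(\<Union>N. {0<..real (Suc N) * h}) = {0<..}"
    proof (intro equalityI subsetI)
      fix y :: real assume "y \<in> {0<..}"
      moreover obtain n :: nat where "y < real n * h" using reals_Archimedean3[OF h] by blast
      moreover have "real n * h \<le> real (Suc n) * h" using h by simp
      ultimately show "y \<in> (\<Union>N. {0<..real (Suc N) * h})" by (intro UN_I[of n]) (simp_all del: of_nat_Suc)
    qed auto
    have "incseq (\<lambda>N. {0<..real (Suc N) * h})"
      by (rule incseq_SucI) (use h in \<open>auto simp: algebra_simps\<close>)
    from set_integral_cont_up[of "\<lambda>N. {0<..real (Suc N) * h}" lborel ?K, OF _ this]
    show ?thesis unfolding U using K_int by simp
  qed
  \<comment> \<open>D is 0 for \<alpha> < 1. For \<alpha> > 1 the sums are multiples of the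
    coefficients of order \<beta> - 1, whose real part is still positive.\<close>
  have lim3: "(\<lambda>N. hp * of_real h * (D * (\<Sum>j\<le>N. gl_coeff \<beta> j))) \<longlonglongrightarrow> 0"
  proof (cases "\<alpha> < 1")
    case False
    have np2: "1 - (\<beta> - 1) \<notin> \<int>\<^sub>\<le>\<^sub>0"
    proof
      assume "1 - (\<beta> - 1) \<in> \<int>\<^sub>\<le>\<^sub>0"
      then obtain n :: nat where "1 - (\<beta> - 1) = - of_nat n" by (auto elim!: nonpos_Ints_cases')
      then have "Re (1 - (\<beta> - 1)) = Re (- of_nat n)" by simp
      then show False using \<beta> \<alpha> by simp
    qed
    have "gl_coeff (\<beta> - 1) \<longlonglongrightarrow> 0" by (rule gl_coeff_tendsto_0[OF np2]) (use False \<alpha> \<beta> in simp)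
    then have "(\<lambda>N. hp * of_real h * (D * (gl_coeff (\<beta> - 1) N / (1 - \<beta>)))) \<longlonglongrightarrow> 0"
      unfolding divide_inverse by (intro tendsto_mult_right_zero tendsto_mult_left_zero)
    then show ?thesis by (simp only: sum_gl_coeff[OF np])
  qed (simp add: D_def)
  have "(\<lambda>N. (\<Sum>j\<le>N. Gamma (1 - \<beta>) * hp * ((\<beta> gchoose j) * (- 1) ^ j * u j)))
      \<longlonglongrightarrow> 0 + (LINT y:{0<..}|lborel. ?K y) + 0"
    unfolding partial by (intro tendsto_add lim1 lim2 lim3)
  then show ?thesis by (simp add: sums_def_le hp_def u_def)
qed

text \<open>The majorant C y^(-\<alpha>) |g y| is independent of h; the limit is tested along
  sequences, where dominated convergence applies. Writing the limit with \<open>exp\<close> and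
  \<open>ln\<close> prepares for the Fourier series of \<theta> at ln y.\<close>

lemma kernel_integral_tendsto:
  assumes \<beta>: "Re \<beta> = \<alpha>"
  shows "((\<lambda>h. LINT y:{0<..}|lborel. gl_kernel \<beta> h y * g y)
    \<longlongrightarrow> (LINT y:{0<..}|lborel. exp (- \<beta> * of_real (ln y)) * g y)) (at_right 0)"
  unfolding tendsto_at_iff_sequentially
proof safe
  fix X :: "nat \<Rightarrow> real" assume X: "\<forall>i. X i \<in> {0<..} - {0}" and X0: "X \<longlonglongrightarrow> 0"
  obtain C where C: "C > 0" "\<And>\<beta> j. Re \<beta> = \<alpha> \<Longrightarrow> norm (gl_coeff \<beta> j) \<le> C * (real j + 1) powr - \<alpha>"
    using gl_coeff_bound[OF \<alpha>] by blast
  have lim: "(\<lambda>i. gl_kernel \<beta> (X i) y) \<longlonglongrightarrow> exp (- \<beta> * of_real (ln y))" if "y > 0" for y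
  proof -
    have "(\<lambda>i. gl_kernel \<beta> (X i) y) \<longlonglongrightarrow> of_real y powr - \<beta>"
      using gl_kernel_tendsto[OF notin_nonpos_Ints[OF \<beta>] that, unfolded tendsto_at_iff_sequentially] X X0
      by (auto simp: o_def)
    then show ?thesis using that by (simp add: powr_def Ln_of_real)
  qed
  have "(\<lambda>i. LINT y:{0<..}|lborel. gl_kernel \<beta> (X i) y * g y)
    \<longlonglongrightarrow> (LINT y:{0<..}|lborel. exp (- \<beta> * of_real (ln y)) * g y)"
    unfolding set_lebesgue_integral_def
  proof (rule integral_dominated_convergence)
    show "integrable lborel (\<lambda>y. indicat_real {0<..} y *\<^sub>R (C * (y powr - \<alpha> * norm (g y))))"
      using set_integrable_mult_right[OF int_g, of C] unfolding set_integrable_def by simp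
    show "AE y in lborel. (\<lambda>i. indicat_real {0<..} y *\<^sub>R (gl_kernel \<beta> (X i) y * g y))
        \<longlonglongrightarrow> indicat_real {0<..} y *\<^sub>R (exp (- \<beta> * of_real (ln y)) * g y)"
    proof (rule AE_I2)
      fix y :: real
      show "(\<lambda>i. indicat_real {0<..} y *\<^sub>R (gl_kernel \<beta> (X i) y * g y))
        \<longlonglongrightarrow> indicat_real {0<..} y *\<^sub>R (exp (- \<beta> * of_real (ln y)) * g y)"
        using lim[of y] by (cases "y > 0") (auto intro!: tendsto_intros)
    qed
    show "AE y in lborel. norm (indicat_real {0<..} y *\<^sub>R (gl_kernel \<beta> (X i) y * g y))
        \<le> indicat_real {0<..} y *\<^sub>R (C * (y powr - \<alpha> * norm (g y)))" for i
    proof (rule AE_I2)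
      fix y :: real
      have "norm (gl_kernel \<beta> (X i) y) * norm (g y) \<le> (C * y powr - \<alpha>) * norm (g y)" if "y > 0"
        using gl_kernel_bound[OF \<alpha>(1) C(2)[OF \<beta>] _ \<beta> _ that, of "X i"] X C(1)
        by (intro mult_right_mono) auto
      then show "norm (indicat_real {0<..} y *\<^sub>R (gl_kernel \<beta> (X i) y * g y))
        \<le> indicat_real {0<..} y *\<^sub>R (C * (y powr - \<alpha> * norm (g y)))"
        by (cases "y > 0") (auto simp: norm_mult mult.assoc)
    qed
  qed measurable
  then show "((\<lambda>h. LINT y:{0<..}|lborel. gl_kernel \<beta> h y * g y) \<circ> X)
    \<longlonglongrightarrow> (LINT y:{0<..}|lborel. exp (- \<beta> * of_real (ln y)) * g y)" by (simp add: o_def)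
qed


text \<open>The sign enters both \<open>omega\<close> and \<open>semifrac_integrand\<close>, so the
  two sides of the final limit carry it alike.\<close>

definition dir_sign :: complex where "dir_sign = (if \<alpha> < 1 then 1 else - 1)"

abbreviation "frac_order c k \<equiv> of_real \<alpha> - freq c \<alpha> k"

lemma GL_inner_summable_outer_eq:
  assumes h: "h > 0"
  shows "summable (GL_inner_term c \<alpha> h f x k)"
    and "GL_outer_term c \<alpha> \<theta> h f x k
      = dir_sign * (fourier_coeff c \<alpha> \<theta> k * (LINT y:{0<..}|lborel. gl_kernel (frac_order c k) h y * g y))"
proof -
  let ?\<beta> = "frac_order c k"
  define A where "A = Gamma (1 - ?\<beta>) * of_real h powr - ?\<beta>"
  \<comment> \<open>Gamma has no zeros away from its poles, so A can be divided out and the inner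
    series inherits summability.\<close>
  have A: "A \<noteq> 0"
    using notin_nonpos_Ints[of ?\<beta>] h by (simp add: A_def Gamma_eq_zero_iff)
  have s: "(\<lambda>j. A * GL_inner_term c \<alpha> h f x k j) sums (LINT y:{0<..}|lborel. gl_kernel ?\<beta> h y * g y)"
    using GL_sums[of ?\<beta> h] h by (simp add: GL_inner_term_def A_def)
  show sm: "summable (GL_inner_term c \<alpha> h f x k)"
    using sums_summable[OF s] A by (rule summable_mult_D)
  have "omega c \<alpha> \<theta> k = dir_sign * fourier_coeff c \<alpha> \<theta> k * Gamma (1 - ?\<beta>)"
    by (simp add: omega_def dir_sign_def algebra_simps)
  moreover have "A * (\<Sum>j. GL_inner_term c \<alpha> h f x k j) = (LINT y:{0<..}|lborel. gl_kernel ?\<beta> h y * g y)"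
    using suminf_mult[OF sm, of A] sums_unique[OF s] by simp
  ultimately show "GL_outer_term c \<alpha> \<theta> h f x k
      = dir_sign * (fourier_coeff c \<alpha> \<theta> k * (LINT y:{0<..}|lborel. gl_kernel ?\<beta> h y * g y))"
    by (simp add: GL_outer_term_def A_def mult.assoc[symmetric] minus_diff_eq)
qed

section \<open>Summation over the Fourier modes\<close>

context
  fixes c :: real and \<theta> :: "real \<Rightarrow> real"
  assumes c: "c > 1" and \<theta>: "smooth_admissable c \<alpha> \<theta>"
begin

lemma theta_measurable [measurable]: "\<theta> \<in> borel_measurable borel"
  using \<theta> by (intro borel_measurable_continuous_onI) (simp add: smooth_admissable_def)

lemmas coeff_summable = fourier_expansion(1)[OF c \<alpha>(1) \<theta>]

lemma norm_exp_freq [simp]: "norm (exp (freq c \<alpha> k * of_real y)) = 1"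
  by (simp add: norm_exp_eq_Re)

text \<open>Read off from the absolutely convergent Fourier series; it supplies the constant T of
  the Fubini argument for the measure.\<close>

lemma theta_le: "\<theta> y \<le> (\<Sum>\<^sub>\<infinity>k. norm (fourier_coeff c \<alpha> \<theta> k))"
proof -
  have "norm (complex_of_real (\<theta> y)) \<le> (\<Sum>\<^sub>\<infinity>k. norm (fourier_coeff c \<alpha> \<theta> k))"
    by (rule norm_infsum_le[OF fourier_expansion(2)[OF c \<alpha>(1) \<theta>] has_sum_infsum[OF coeff_summable]])
       (simp add: norm_mult)
  then show ?thesis by simp
qed

text \<open>y^(-\<alpha>) \<theta> (ln y) is the sum of the c_k y^(-\<beta>_k). The common bound W
  on the integrals gives an unconditional sum; its value is found along symmetric partial sums of
  the Fourier series, which are bounded by the sum of all |c_k| and so admit dominated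
  convergence.\<close>

lemma fourier_sum_of_power_integrals:
  "((\<lambda>k. fourier_coeff c \<alpha> \<theta> k * (LINT y:{0<..}|lborel. exp (- frac_order c k * of_real (ln y)) * g y))
    has_sum (LINT y:{0<..}|lborel. of_real (y powr - \<alpha> * \<theta> (ln y)) * g y)) UNIV"
proof -
  let ?c = "fourier_coeff c \<alpha> \<theta>"
  let ?I = "\<lambda>k. LINT y:{0<..}|lborel. exp (- frac_order c k * of_real (ln y)) * g y"
  let ?J = "LINT y:{0<..}|lborel. of_real (y powr - \<alpha> * \<theta> (ln y)) * g y"
  define T where "T = (\<Sum>\<^sub>\<infinity>k. norm (?c k))"
  have e_meas: "(\<lambda>y. exp (- frac_order c k * of_real (ln y))) \<in> borel_measurable borel" for k
    by measurable
  have e_eq: "exp (- frac_order c k * of_real (ln y)) = of_real (y powr - \<alpha>) * exp (freq c \<alpha> k * of_real (ln y))"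
    if "y > 0" for y k
  proof -
    have "complex_of_real (y powr - \<alpha>) = exp (- of_real \<alpha> * of_real (ln y))"
      using that by (simp add: powr_def exp_of_real[symmetric])
    then show ?thesis by (simp add: exp_add[symmetric] algebra_simps)
  qed
  have e_norm: "norm (exp (- frac_order c k * of_real (ln y))) \<le> 1 * y powr - \<alpha>" if "y > 0" for y k
    unfolding e_eq[OF that] by (simp add: norm_mult)
  note I_int = dominated(1)[OF e_meas e_norm]
  have I_le: "norm (?I k) \<le> W" for k
    using dominated(2)[OF e_meas e_norm] by simp
  have "(\<lambda>k. norm (?c k * ?I k)) summable_on UNIV"
  proof (rule Infinite_Sum.abs_summable_on_comparison_test)
    show "(\<lambda>k. norm (norm (?c k) * W)) summable_on UNIV"
      using summable_on_cmult_left[OF coeff_summable, of "\<bar>W\<bar>"] by (simp add: abs_mult)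
    show "norm (?c k * ?I k) \<le> norm (norm (?c k) * W)" for k
      using mult_left_mono[OF order_trans[OF I_le abs_ge_self], of "norm (?c k)"]
      by (simp add: norm_mult abs_mult)
  qed
  then have "(\<lambda>k. ?c k * ?I k) summable_on UNIV" by (rule Infinite_Sum.abs_summable_summable)
  then obtain S where S: "((\<lambda>k. ?c k * ?I k) has_sum S) UNIV" by (auto simp: summable_on_def)
  define Fou where "Fou N t = (\<Sum>k\<in>{- int N..int N}. ?c k * exp (freq c \<alpha> k * of_real t))" for N t
  have [measurable]: "Fou N \<in> borel_measurable borel" for N
    unfolding Fou_def by measurable
  have Fou_le: "norm (Fou N t) \<le> T" for N t
  proof -
    have "norm (Fou N t) \<le> (\<Sum>k\<in>{- int N..int N}. norm (?c k))"
      unfolding Fou_def by (rule order_trans[OF norm_sum]) (simp add: norm_mult)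
    also have "\<dots> \<le> T" unfolding T_def
      by (intro finite_sum_le_infsum coeff_summable) auto
    finally show ?thesis .
  qed
  have Fou_lim: "(\<lambda>N. Fou N t) \<longlonglongrightarrow> of_real (\<theta> t)" for t
    unfolding Fou_def by (rule has_sum_symmetric_limit[OF fourier_expansion(2)[OF c \<alpha>(1) \<theta>]])
  have part: "(\<Sum>k\<in>{- int N..int N}. ?c k * ?I k)
      = (LINT y:{0<..}|lborel. of_real (y powr - \<alpha>) * Fou N (ln y) * g y)" for N
  proof -
    have "(\<Sum>k\<in>{- int N..int N}. ?c k * ?I k)
        = (\<Sum>k\<in>{- int N..int N}. LINT y:{0<..}|lborel. ?c k * (exp (- frac_order c k * of_real (ln y)) * g y))"
      by simp
    also have "\<dots> = (LINT y:{0<..}|lborel. \<Sum>k\<in>{- int N..int N}. ?c k * (exp (- frac_order c k * of_real (ln y)) * g y))"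
      unfolding set_lebesgue_integral_def scaleR_sum_right
      by (rule Bochner_Integration.integral_sum[symmetric])
         (use set_integrable_mult_right[OF I_int] in \<open>simp add: set_integrable_def\<close>)
    also have "\<dots> = (LINT y:{0<..}|lborel. of_real (y powr - \<alpha>) * Fou N (ln y) * g y)"
    proof (rule set_lebesgue_integral_cong, simp, intro allI impI)
      fix y :: real assume "y \<in> {0<..}"
      then have "y > 0" by simp
      show "(\<Sum>k\<in>{- int N..int N}. ?c k * (exp (- frac_order c k * of_real (ln y)) * g y))
          = of_real (y powr - \<alpha>) * Fou N (ln y) * g y"
        unfolding e_eq[OF \<open>y > 0\<close>] Fou_def sum_distrib_left sum_distrib_right
        by (intro sum.cong refl) (simp only: mult_ac)
    qed
    finally show ?thesis .
  qed
  have "(\<lambda>N. LINT y:{0<..}|lborel. of_real (y powr - \<alpha>) * Fou N (ln y) * g y) \<longlonglongrightarrow> ?J"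
    unfolding set_lebesgue_integral_def
  proof (rule integral_dominated_convergence)
    show "integrable lborel (\<lambda>y. indicat_real {0<..} y *\<^sub>R (T * (y powr - \<alpha> * norm (g y))))"
      using set_integrable_mult_right[OF int_g, of T] unfolding set_integrable_def by simp
    show "AE y in lborel. (\<lambda>N. indicat_real {0<..} y *\<^sub>R (of_real (y powr - \<alpha>) * Fou N (ln y) * g y))
        \<longlonglongrightarrow> indicat_real {0<..} y *\<^sub>R (of_real (y powr - \<alpha> * \<theta> (ln y)) * g y)"
      unfolding of_real_mult by (intro AE_I2 tendsto_intros Fou_lim)
    show "AE y in lborel. norm (indicat_real {0<..} y *\<^sub>R (of_real (y powr - \<alpha>) * Fou N (ln y) * g y))
        \<le> indicat_real {0<..} y *\<^sub>R (T * (y powr - \<alpha> * norm (g y)))" for N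
    proof (rule AE_I2)
      fix y :: real
      have "norm (Fou N (ln y)) * (y powr - \<alpha> * norm (g y)) \<le> T * (y powr - \<alpha> * norm (g y))"
        by (intro mult_right_mono Fou_le) auto
      then show "norm (indicat_real {0<..} y *\<^sub>R (of_real (y powr - \<alpha>) * Fou N (ln y) * g y))
        \<le> indicat_real {0<..} y *\<^sub>R (T * (y powr - \<alpha> * norm (g y)))"
        by (cases "y > 0") (auto simp: norm_mult mult_ac)
    qed
  qed measurable
  then have "(\<lambda>N. \<Sum>k\<in>{- int N..int N}. ?c k * ?I k) \<longlonglongrightarrow> ?J" unfolding part .
  then have "S = ?J" using has_sum_symmetric_limit[OF S] LIMSEQ_unique by blast
  then show ?thesis using S by simp
qed

text \<open>Tannery's theorem with majorant |c_k| |C W|, available because all orders have real part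
  \<alpha> and hence share one C. The same majorant yields convergence of the outer sum for each
  fixed h > 0.\<close>

lemma GL_difference_tendsto:
  shows "\<And>h. h > 0 \<Longrightarrow> GL_converges c \<alpha> \<theta> h f x"
    and "((\<lambda>h. GL_difference c \<alpha> \<theta> h f x)
      \<longlongrightarrow> dir_sign * (LINT y:{0<..}|lborel. of_real (y powr - \<alpha> * \<theta> (ln y)) * g y)) (at_right 0)"
proof -
  let ?c = "fourier_coeff c \<alpha> \<theta>"
  define I where "I k h = (LINT y:{0<..}|lborel. gl_kernel (frac_order c k) h y * g y)" for k h
  obtain C where C: "C > 0" "\<And>\<beta> j. Re \<beta> = \<alpha> \<Longrightarrow> norm (gl_coeff \<beta> j) \<le> C * (real j + 1) powr - \<alpha>"
    using gl_coeff_bound[OF \<alpha>] by blast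
  \<comment> \<open>The absolute value makes the majorant nonnegative without an argument about the
    sign of W.\<close>
  define M where "M k = norm (?c k) * \<bar>C * W\<bar>" for k
  have I_le: "norm (I k h) \<le> \<bar>C * W\<bar>" if "h > 0" for k h
    unfolding I_def
    by (rule order_trans[OF dominated(2)[OF gl_kernel_measurable gl_kernel_bound[OF \<alpha>(1) C(2) _ _ that]] abs_ge_self])
       (use C in auto)
  have M: "M summable_on UNIV" unfolding M_def by (rule summable_on_cmult_left[OF coeff_summable])
  have bound: "norm (?c k * I k h) \<le> M k" if "h > 0" for k h
    using mult_left_mono[OF I_le[OF that], of "norm (?c k)"] by (simp add: M_def norm_mult)
  have outer: "GL_outer_term c \<alpha> \<theta> h f x k = dir_sign * (?c k * I k h)" if "h > 0" for h k
    using GL_inner_summable_outer_eq(2)[OF that] by (simp add: I_def)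
  have nM: "norm (M k) = M k" for k by (simp add: M_def)
  have sm: "(\<lambda>k. ?c k * I k h) summable_on UNIV" if "h > 0" for h
    by (rule Infinite_Sum.abs_summable_summable, rule Infinite_Sum.abs_summable_on_comparison_test[of M])
       (use M bound[OF that] in \<open>simp_all only: nM\<close>)
  show "GL_converges c \<alpha> \<theta> h f x" if "h > 0" for h
    unfolding GL_converges_def outer[OF that]
    using GL_inner_summable_outer_eq(1)[OF that] summable_on_cmult_right[OF sm[OF that]] by blast
  have ev: "eventually (\<lambda>h::real. h > 0) (at_right 0)" by (simp add: eventually_at_right_less)
  have "((\<lambda>h. \<Sum>\<^sub>\<infinity>k. ?c k * I k h)
      \<longlongrightarrow> (\<Sum>\<^sub>\<infinity>k. ?c k * (LINT y:{0<..}|lborel. exp (- frac_order c k * of_real (ln y)) * g y))) (at_right 0)"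
  proof (rule tendsto_infsum_dominated[OF _ M])
    show "((\<lambda>h. ?c k * I k h) \<longlongrightarrow> ?c k * (LINT y:{0<..}|lborel. exp (- frac_order c k * of_real (ln y)) * g y)) (at_right 0)" for k
      unfolding I_def by (intro tendsto_mult_left kernel_integral_tendsto) simp
    show "eventually (\<lambda>h. \<forall>k. norm (?c k * I k h) \<le> M k) (at_right 0)"
      using ev by eventually_elim (use bound in blast)
  qed simp
  then have "((\<lambda>h. dir_sign * (\<Sum>\<^sub>\<infinity>k. ?c k * I k h))
      \<longlongrightarrow> dir_sign * (LINT y:{0<..}|lborel. of_real (y powr - \<alpha> * \<theta> (ln y)) * g y)) (at_right 0)"
    unfolding infsumI[OF fourier_sum_of_power_integrals] by (rule tendsto_mult_left)
  moreover have "eventually (\<lambda>h. dir_sign * (\<Sum>\<^sub>\<infinity>k. ?c k * I k h) = GL_difference c \<alpha> \<theta> h f x) (at_right 0)"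
    using ev
  proof eventually_elim
    case (elim h)
    then show ?case by (simp add: GL_difference_def outer infsum_cmult_right sm)
  qed
  ultimately show "((\<lambda>h. GL_difference c \<alpha> \<theta> h f x)
      \<longlongrightarrow> dir_sign * (LINT y:{0<..}|lborel. of_real (y powr - \<alpha> * \<theta> (ln y)) * g y)) (at_right 0)"
    by (rule Lim_transform_eventually)
qed

lemma semifrac_deriv_eq:
  assumes \<phi>: "is_levy_measure \<alpha> \<theta> \<phi>"
  shows "integrable \<phi> (semifrac_integrand \<alpha> f x)"
    and "semifrac_deriv \<alpha> \<phi> f x = dir_sign * (LINT y:{0<..}|lborel. of_real (y powr - \<alpha> * \<theta> (ln y)) * g y)"
proof -
  have pos: "\<theta> y > 0" for y using \<theta> by (simp add: smooth_admissable_def admissable_def)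
  note prim = levy_measure_primitive_integral[OF \<phi> theta_measurable pos theta_le meas_g int_g]
  have space: "space \<phi> = {0<..}"
    using \<phi> sets_eq_imp_space_eq[of \<phi> "restrict_space borel {0<..}"]
    by (simp add: is_levy_measure_def space_restrict_space)
  have eq: "semifrac_integrand \<alpha> f x y = dir_sign * (LINT s:{0<..<y}|lborel. g s)" if "y \<in> space \<phi>" for y
    using semifrac_integrand_eq[of y] that by (simp add: space dir_sign_def)
  show "integrable \<phi> (semifrac_integrand \<alpha> f x)"
    using integrable_mult_right[OF prim(1), of dir_sign] eq
    by (subst Bochner_Integration.integrable_cong[OF refl eq]) auto
  have "semifrac_deriv \<alpha> \<phi> f x = (LINT y|\<phi>. dir_sign * (LINT s:{0<..<y}|lborel. g s))"
    unfolding semifrac_deriv_def by (rule Bochner_Integration.integral_cong[OF refl eq])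
  then show "semifrac_deriv \<alpha> \<phi> f x = dir_sign * (LINT y:{0<..}|lborel. of_real (y powr - \<alpha> * \<theta> (ln y)) * g y)"
    by (simp add: prim(2))
qed

end

end

theorem theorem4p4:
  fixes c \<alpha> :: real and \<theta> :: "real \<Rightarrow> real" and \<phi> :: "real measure"
    and f :: "real \<Rightarrow> complex" and n :: nat
  assumes "c > 1" and "0 < \<alpha>" and "\<alpha> < 2" and "\<alpha> \<noteq> 1"
    and "smooth_admissable c \<alpha> \<theta>"
    and "is_levy_measure \<alpha> \<theta> \<phi>"
    and "integrable lborel f" and "bounded (range f)"
    and "real n > \<alpha> + 1"
    and "derivs_exist_upto n f"
    and "integrable lborel (nth_deriv n f)"
  shows "AE x in lborel.
     integrable \<phi> (semifrac_integrand \<alpha> f x) \<and>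
     (\<forall>h>0. GL_converges c \<alpha> \<theta> h f x) \<and>
     ((\<lambda>h. GL_difference c \<alpha> \<theta> h f x) \<longlongrightarrow> semifrac_deriv \<alpha> \<phi> f x) (at_right 0) \<and>
     ((\<lambda>h. \<Sum>\<^sub>\<infinity>k::int. omega c \<alpha> \<theta> k * complex_of_real h powr (freq c \<alpha> k - of_real \<alpha>)
            * (\<Sum>j. ((of_real \<alpha> - freq c \<alpha> k) gchoose j) * (- 1) ^ j * f (x - real j * h)))
        \<longlongrightarrow> semifrac_deriv \<alpha> \<phi> f x) (at_right 0)"
proof (rule AE_I2)
  fix x :: real
  note \<alpha> = assms(2-4)
  \<comment> \<open>With n \<ge> 2 both f' and f'' are integrable, and integrability of f'' makes f'
    bounded.\<close>
  have n: "n \<ge> 2" using \<open>real n > \<alpha> + 1\<close> \<alpha>(1) by linarith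
  define d where "d k = nth_deriv k f" for k
  have d0: "d 0 = f" by (simp add: d_def nth_deriv_def)
  have der: "(d k has_vector_derivative d (Suc k) y) (at y)" if "k < n" for k y
    unfolding d_def by (rule nth_deriv_has_vector_derivative[OF assms(10) that])
  have L1: "integrable lborel (d k)" if "k \<le> n" for k
    unfolding d_def by (rule nth_deriv_integrable[OF assms(10,7,11) that])
  have bdd: "\<exists>B. \<forall>y. norm (d k y) \<le> B" if "k < n" for k
    by (rule bounded_if_deriv_integrable[OF der[OF that] L1 L1]) (use that in auto)
  obtain B where B: "\<And>y. norm (d 1 y) \<le> B" using bdd[of 1] n by auto
  have cont: "continuous_on UNIV (d 1)"
    using has_vector_derivative_continuous[OF der[of 1]] n by (simp add: continuous_at_imp_continuous_on)
  define D where "D = (if \<alpha> < 1 then 0 else d 1 x)"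
  define g where "g y = d 1 (x - y) - D" for y
  have g_meas: "g \<in> borel_measurable borel"
    unfolding g_def
    by (intro borel_measurable_continuous_onI continuous_intros continuous_on_compose2[OF cont]) auto
  have g_le: "norm (g y) \<le> B + norm D" for y
    unfolding g_def using norm_triangle_ineq4[of "d 1 (x - y)" D] B[of "x - y"] by linarith
  have "set_integrable lborel {0<..} (\<lambda>y. y powr - \<alpha> * norm (g y))"
  proof (cases "\<alpha> < 1")
    case True
    have "integrable lborel g"
      using lborel_integrable_real_affine[OF L1[of 1], of "- 1" x] n True by (simp add: g_def[abs_def] D_def)
    then show ?thesis by (intro weighted_integrable[OF g_meas g_le, where C = 0]) (use \<alpha> True in auto)
  next
    case False
    \<comment> \<open>For \<alpha> > 1 the third derivative is integrable too, so f'' is bounded;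
      this gives the linear bound on g used near 0.\<close>
    then have n3: "2 < n" using \<open>real n > \<alpha> + 1\<close> \<alpha> by linarith
    obtain C where C: "\<And>y. norm (d 2 y) \<le> C" using bdd[OF n3] by auto
    have "norm (g y) \<le> C * y" if "y > 0" for y
    proof -
      have "norm (d 1 (x - y) - d 1 x) \<le> C * norm ((x - y) - x)"
      proof (rule differentiable_bound[of UNIV "d 1"])
        fix z
        show "(d 1 has_derivative (\<lambda>t. t *\<^sub>R d 2 z)) (at z within UNIV)"
          using der[of 1 z] n by (simp add: has_vector_derivative_def numeral_2_eq_2)
        show "onorm (\<lambda>t. t *\<^sub>R d 2 z) \<le> C"
        proof (rule onorm_le)
          show "norm (t *\<^sub>R d 2 z) \<le> C * norm t" for t
            using mult_right_mono[OF C[of z], of "\<bar>t\<bar>"] by (simp add: mult.commute)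
        qed
      qed auto
      then show ?thesis using False that by (simp add: g_def D_def)
    qed
    then show ?thesis by (intro weighted_integrable[OF g_meas g_le, where C = C]) (use \<alpha> False in auto)
  qed
  then have int: "set_integrable lborel {0<..} (\<lambda>y. y powr - \<alpha> * norm (d 1 (x - y) - (if \<alpha> < 1 then 0 else d 1 x)))"
    by (simp add: g_def D_def)
  interpret gl_point \<alpha> f "d 1" x
  proof
    show "(f has_vector_derivative d 1 y) (at y)" for y using der[of 0 y] n by (simp add: d0)
  qed (use \<alpha> cont assms(8) int in auto)
  note lim = GL_difference_tendsto[OF assms(1,5)]
  have lim2: "((\<lambda>h. GL_difference c \<alpha> \<theta> h f x) \<longlongrightarrow> semifrac_deriv \<alpha> \<phi> f x) (at_right 0)"
    unfolding semifrac_deriv_eq(2)[OF assms(1,5,6)] by (rule lim(2))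
  then show "integrable \<phi> (semifrac_integrand \<alpha> f x) \<and>
     (\<forall>h>0. GL_converges c \<alpha> \<theta> h f x) \<and>
     ((\<lambda>h. GL_difference c \<alpha> \<theta> h f x) \<longlongrightarrow> semifrac_deriv \<alpha> \<phi> f x) (at_right 0) \<and>
     ((\<lambda>h. \<Sum>\<^sub>\<infinity>k::int. omega c \<alpha> \<theta> k * complex_of_real h powr (freq c \<alpha> k - of_real \<alpha>)
            * (\<Sum>j. ((of_real \<alpha> - freq c \<alpha> k) gchoose j) * (- 1) ^ j * f (x - real j * h)))
        \<longlongrightarrow> semifrac_deriv \<alpha> \<phi> f x) (at_right 0)"
    using semifrac_deriv_eq(1)[OF assms(1,5,6)] lim(1)
    by (simp add: GL_difference_def GL_outer_term_def GL_inner_term_def)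
qed

end
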